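(* Let $0<\lambda\le\Lambda$ and define $$\tilde\alpha=\frac{\lambda}{2(\Lambda+\lambda)}\left(\sqrt{33+30\frac{\lambda}{\Lambda}+\frac{\lambda^2}{\Lambda^2}}-3-\frac{\lambda}{\Lambda}\right).$$ Then there exists a constant $C=C(\lambda,\Lambda)$, depending only on $\lambda$ and $\Lambda$, such that the following holds. For every continuous function $F:\mathrm{Sym}_2\to\mathbb{R}$ that is uniformly elliptic with ellipticity constants $\lambda,\Lambda$, and every $u\in C^2(B_1)$, $B_1\subset\mathbb{R}^2$, satisfying $F(D^2u)=0$ in $B_1$, one has $$\|u\|_{C^{2,\tilde\alpha}(B_{1/2})}\le C(\lambda,\Lambda)\,\|u\|_{L^\infty(B_1)}.$$
   Context: $\mathrm{Sym}_2$ denotes the space of real symmetric $2\times 2$ matrices, and $B_r\subset\mathbb{R}^2$ is the open ball of radius $r$ centered at the origin. $D^2u$ is the Hessian of $u$. A function $F:\mathrm{Sym}_2\to\mathbb{R}$ is uniformly elliptic with ellipticity constants $0<\lambda\le\Lambda$ if for all $M,N\in\mathrm{Sym}_2$ with $N\ge 0$ (positive semidefinite), $$\lambda\,\mathrm{Tr}(N)\le F(M+N)-F(M)\le\Lambda\,\mathrm{Tr}(N).$$ No convexity, concavity or differentiability of $F$ is assumed. $\|\cdot\|_{C^{2,\alpha}(B_{1/2})}$ is the usual full Hölder norm (sup norms of $u$, $Du$, $D^2u$ plus the $\alpha$-Hölder seminorm of $D^2u$ on $B_{1/2}$; for $\alpha=1$ the Lipschitz seminorm of $D^2u$). *)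

theory Defs
  imports "HOL-Analysis.Analysis" "HOL-Probability.Essential_Supremum"
begin

definition Sym2 :: "(real^2^2) set"
  where "Sym2 = {M. transpose M = M}"

definition pos_semidef :: "real^2^2 \<Rightarrow> bool"
  where "pos_semidef N \<longleftrightarrow> (\<forall>v. 0 \<le> v \<bullet> (N *v v))"

text \<open>The operators of interest are functions on symmetric matrices; a function of type
  \<open>real^2^2 \<Rightarrow> real\<close> is only ever constrained, and (see below) only ever evaluated, on \<open>Sym2\<close>.\<close>

definition uniformly_elliptic :: "real \<Rightarrow> real \<Rightarrow> (real^2^2 \<Rightarrow> real) \<Rightarrow> bool"
  where "uniformly_elliptic lam Lam F \<longleftrightarrow>
    0 < lam \<and> lam \<le> Lam \<and>
    (\<forall>M\<in>Sym2. \<forall>N\<in>Sym2. pos_semidef N \<longrightarrow>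
       lam * trace N \<le> F (M + N) - F M \<and> F (M + N) - F M \<le> Lam * trace N)"

definition gradient :: "(real^2 \<Rightarrow> real) \<Rightarrow> real^2 \<Rightarrow> real^2"
  where "gradient u x = (\<chi> i. frechet_derivative u (at x) (axis i 1))"

text \<open>The entry \<open>hessian u x $ i $ j\<close> is the partial derivative in direction \<open>j\<close> of the
  \<open>i\<close>-th partial derivative of \<open>u\<close>; wherever \<open>C2_on\<close> below holds, the matrix lies in \<open>Sym2\<close>
  by Schwarz's theorem.\<close>

definition hessian :: "(real^2 \<Rightarrow> real) \<Rightarrow> real^2 \<Rightarrow> real^2^2"
  where "hessian u x = jacobian (gradient u) (at x)"

text \<open>Meant for open \<open>S\<close>: the derivatives involved are two-sided.\<close>

definition C2_on :: "(real^2) set \<Rightarrow> (real^2 \<Rightarrow> real) \<Rightarrow> bool"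
  where "C2_on S u \<longleftrightarrow>
    (\<forall>x\<in>S. u differentiable (at x)) \<and>
    (\<forall>x\<in>S. gradient u differentiable (at x)) \<and>
    continuous_on S (hessian u)"

text \<open>Norms take values in \<open>ennreal\<close>, so that unbounded functions have norm \<open>\<infinity>\<close>. The norm on
  \<open>real^2^2\<close> is the Frobenius norm.\<close>

definition sup_norm_on :: "'a set \<Rightarrow> ('a \<Rightarrow> 'b::real_normed_vector) \<Rightarrow> ennreal"
  where "sup_norm_on S f = (SUP x\<in>S. ennreal (norm (f x)))"

definition holder_seminorm_on ::
    "real \<Rightarrow> 'a::metric_space set \<Rightarrow> ('a \<Rightarrow> 'b::real_normed_vector) \<Rightarrow> ennreal"
  where "holder_seminorm_on \<alpha> S f =
    (SUP (x, y)\<in>{(x, y). x \<in> S \<and> y \<in> S \<and> x \<noteq> y}.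
       ennreal (norm (f x - f y) / dist x y powr \<alpha>))"

definition C2_holder_norm_on :: "real \<Rightarrow> (real^2) set \<Rightarrow> (real^2 \<Rightarrow> real) \<Rightarrow> ennreal"
  where "C2_holder_norm_on \<alpha> S u =
    sup_norm_on S u + sup_norm_on S (gradient u) + sup_norm_on S (hessian u)
      + holder_seminorm_on \<alpha> S (hessian u)"

definition Linf_norm_on :: "(real^2) set \<Rightarrow> (real^2 \<Rightarrow> real) \<Rightarrow> ennreal"
  where "Linf_norm_on S u = esssup (lebesgue_on S) (\<lambda>x. ennreal \<bar>u x\<bar>)"

definition alpha_tilde :: "real \<Rightarrow> real \<Rightarrow> real"
  where "alpha_tilde lam Lam =
    lam / (2 * (Lam + lam)) *
      (sqrt (33 + 30 * (lam / Lam) + lam\<^sup>2 / Lam\<^sup>2) - 3 - lam / Lam)"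

end

theory Submission
  imports Defs
begin

text \<open>Increments \<open>v = u(\<cdot> + k) - u\<close> satisfy \<open>F A = F B\<close> for the Hessians \<open>A\<close>, \<open>B\<close> of the two terms, so
  \<open>D\<^sup>2v\<close> lies in the cone of matrices whose eigenvalues have opposite signs and ratio between \<open>1/K\<close> and
  \<open>K = \<Lambda>/\<lambda>\<close>. In an orthonormal frame (radial, tangential) this gives
  \<open>- det D\<^sup>2v \<ge> 2/(K + 1) b\<^sup>2 + 1/K c\<^sup>2\<close>, where \<open>(b, c)\<close> is the tangential derivative of \<open>\<nabla>v\<close>. On a circle
  \<open>\<integral> - det D\<^sup>2v\<close> is also a boundary integral of \<open>\<nabla>v\<close>; comparing Fourier modes of both, the worst one is the
  second, and it yields \<open>r h' \<ge> 2\<alpha> h\<close> for \<open>h(r) = \<integral> - det D\<^sup>2v\<close> over the ball of radius \<open>r\<close>, with exactly the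
  exponent \<open>\<alpha>\<close> of the theorem. Hence \<open>h(r) \<le> C r\<^sup>2\<^sup>\<alpha>\<close>, and Morrey's argument gives a Hoelder bound for \<open>\<nabla>v\<close>
  in terms of \<open>sup \<bar>\<nabla>v\<bar>\<close>, which in turn bounds \<open>\<nabla>v(x)\<close> by \<open>sup \<bar>v\<bar>\<close>. Applied to \<open>v\<close> this controls
  increments of \<open>\<nabla>u\<close> and so \<open>\<nabla>u\<close>; applied to \<open>v/\<bar>k\<bar>\<close> it controls \<open>D\<^sup>2u\<close> and its Hoelder seminorm.\<close>

section \<open>Wirtinger inequalities\<close>

text \<open>\<open>F\<close> need not be differentiable and \<open>F 0\<close> need not vanish, so
  the equation cannot be linearised and the Hessian of \<open>u\<close> itself need not lie in the
  cone; only differences of two Hessians are constrained. Hence the estimates concern an abstract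
  C^1 field with derivative in the cone, and they are used twice: plain increments of
  \<open>u\<close>, bounded by \<open>2 * A\<close>, yield the Lipschitz bound that makes the
  quotients v/|k| bounded uniformly in k. The comparison of modes is done without Fourier series.
  Splitting a field on the circle into parts even and odd under the antipodal map leads to functions
  of period pi, for which Wirtinger's inequality has the constant 4; what remains is a sum of
  squares, Wirtinger deficits and total derivatives. With \<beta> = 2/(K + 1) and \<gamma> = 1/K the
  exponent is the positive root of (\<alpha> + \<beta>)(\<alpha> + \<gamma>) = 4 \<beta> \<gamma>.
  Values at points are reached through circles: among the radii between d and 2d one has small
  energy, so the field varies little on that circle and stays near its value at the centre. Two such
  circles about points at distance d intersect.\<close>

lemma wirtinger_dirichlet:
  fixes w w' :: "real \<Rightarrow> real"
  assumes ab: "a < b"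
    and w: "\<And>t. t \<in> {a..b} \<Longrightarrow> (w has_real_derivative w' t) (at t)"
    and w': "continuous_on {a..b} w'"
    and bd: "w a = 0" "w b = 0"
  shows "(pi / (b - a))\<^sup>2 * integral {a..b} (\<lambda>t. (w t)\<^sup>2) \<le> integral {a..b} (\<lambda>t. (w' t)\<^sup>2)"
proof -
  define k where "k = pi / (b - a)"
  define c where "c = (a + b) / 2"
  have k: "k > 0" using ab by (simp add: k_def)
  have cw: "continuous_on {a..b} w"
    using w by (meson DERIV_isCont continuous_at_imp_continuous_on)
  \<comment> \<open>For \<mu> below the critical value \<open>k\<close> the tangent used here stays
    finite on the closed interval; the sharp constant follows by letting \<mu> tend to
    \<open>k\<close>.\<close>
  have *: "\<mu>\<^sup>2 * integral {a..b} (\<lambda>t. (w t)\<^sup>2) \<le> integral {a..b} (\<lambda>t. (w' t)\<^sup>2)"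
    if \<mu>: "0 < \<mu>" "\<mu> < k" for \<mu>
  proof -
    have cos: "cos (\<mu> * (t - c)) > 0" if "t \<in> {a..b}" for t
    proof -
      have "\<bar>t - c\<bar> \<le> (b - a) / 2"
        using that by (auto simp: c_def abs_le_iff field_simps)
      then have "\<bar>\<mu> * (t - c)\<bar> \<le> \<mu> * ((b - a) / 2)"
        using \<mu> by (simp add: abs_mult mult_left_mono)
      also have "\<dots> < k * ((b - a) / 2)"
        using \<mu> ab by (intro mult_strict_right_mono) auto
      also have "\<dots> = pi / 2"
        using ab by (simp add: k_def)
      finally show ?thesis
        by (intro cos_gt_zero_pi) (auto simp: abs_less_iff)
    qed
    define T where "T t = tan (\<mu> * (t - c))" for t
    \<comment> \<open>\<open>D\<close> is the derivative of
      \<open>\<mu> * (w t)\<^sup>2 * T t\<close>, which vanishes at both ends, and adding it to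
      \<open>(w' t)\<^sup>2 - \<mu>\<^sup>2 * (w t)\<^sup>2\<close> gives the perfect square
      \<open>(w' t + \<mu> * w t * T t)\<^sup>2\<close>.\<close>
    define D where "D t = 2 * \<mu> * w t * w' t * T t + \<mu>\<^sup>2 * (w t)\<^sup>2 * (1 + (T t)\<^sup>2)" for t
    have cT: "continuous_on {a..b} T"
      unfolding T_def using cos by (intro continuous_intros) force
    have dG: "((\<lambda>t. \<mu> * (w t)\<^sup>2 * T t) has_real_derivative D t) (at t)" if "t \<in> {a..b}" for t
    proof -
      have "(T has_real_derivative \<mu> * (1 + (T t)\<^sup>2)) (at t)"
        unfolding T_def using cos[OF that]
        by (auto intro!: derivative_eq_intros simp: tan_sec power_inverse)
      then show ?thesis
        unfolding D_def using w[OF that]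
        by (auto intro!: derivative_eq_intros simp: algebra_simps power2_eq_square)
    qed
    have "(D has_integral \<mu> * (w b)\<^sup>2 * T b - \<mu> * (w a)\<^sup>2 * T a) {a..b}"
      using ab dG
      by (intro fundamental_theorem_of_calculus)
         (auto simp: has_real_derivative_iff_has_vector_derivative[symmetric]
               intro: has_field_derivative_at_within)
    then have D0: "(D has_integral 0) {a..b}" using bd by simp
    have i1: "(\<lambda>t. (w t)\<^sup>2) integrable_on {a..b}" "(\<lambda>t. (w' t)\<^sup>2) integrable_on {a..b}"
      by (intro integrable_continuous_real continuous_intros cw w')+
    have i2: "(\<lambda>t. \<mu>\<^sup>2 * (w t)\<^sup>2 - D t) integrable_on {a..b}"
      using i1 D0 by (intro integrable_diff integrable_on_mult_right) auto
    have "\<mu>\<^sup>2 * integral {a..b} (\<lambda>t. (w t)\<^sup>2) = integral {a..b} (\<lambda>t. \<mu>\<^sup>2 * (w t)\<^sup>2 - D t)"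
      using i1 D0 by (subst integral_diff) (auto simp: integral_unique intro: integrable_on_mult_right)
    also have "\<dots> \<le> integral {a..b} (\<lambda>t. (w' t)\<^sup>2)"
    proof (rule integral_le)
      show "\<mu>\<^sup>2 * (w t)\<^sup>2 - D t \<le> (w' t)\<^sup>2" for t
        using zero_le_power2[of "w' t + \<mu> * w t * T t"]
        by (simp add: D_def algebra_simps power2_eq_square)
    qed (use i1 i2 in auto)
    finally show ?thesis .
  qed
  have "((\<lambda>\<mu>. \<mu>\<^sup>2 * integral {a..b} (\<lambda>t. (w t)\<^sup>2)) \<longlongrightarrow> k\<^sup>2 * integral {a..b} (\<lambda>t. (w t)\<^sup>2)) (at_left k)"
    by (intro tendsto_intros)
  moreover have "eventually (\<lambda>\<mu>. \<mu>\<^sup>2 * integral {a..b} (\<lambda>t. (w t)\<^sup>2) \<le> integral {a..b} (\<lambda>t. (w' t)\<^sup>2)) (at_left k)"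
    using k * by (intro eventually_at_leftI[of 0]) auto
  ultimately show ?thesis
    unfolding k_def[symmetric] by (rule tendsto_upperbound) auto
qed

lemma integral_periodic_shift:
  fixes g :: "real \<Rightarrow> real"
  assumes g: "continuous_on UNIV g" and per: "\<And>t. g (t + T) = g t" and a: "0 \<le> a" "a \<le> T"
  shows "integral {a..a + T} g = integral {0..T} g"
proof -
  have int: "g integrable_on {x..y}" for x y
    by (intro integrable_continuous_real continuous_on_subset[OF g]) auto
  have "integral {T..a + T} g = integral {0..a} (g \<circ> (\<lambda>x. x + T))"
    using integral_shift[of 0 T a g] g continuous_on_subset by fastforce
  also have "g \<circ> (\<lambda>x. x + T) = g" by (auto simp: per)
  finally have "integral {T..a + T} g = integral {0..a} g" .
  moreover have "integral {0..a} g + integral {a..T} g = integral {0..T} g"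
    using a int by (intro Henstock_Kurzweil_Integration.integral_combine) auto
  moreover have "integral {a..T} g + integral {T..a + T} g = integral {a..a + T} g"
    using a int by (intro Henstock_Kurzweil_Integration.integral_combine) auto
  ultimately show ?thesis by simp
qed

lemma periodic_derivative:
  fixes y :: "real \<Rightarrow> real"
  assumes "\<And>t. (y has_real_derivative y' t) (at t)" "\<And>t. y (t + T) = y t"
  shows "y' (t + T) = y' t"
proof -
  have "((\<lambda>t. y (t + T)) has_real_derivative y' (t + T)) (at t)"
    using assms(1)[of "t + T"] by (simp only: DERIV_shift)
  then show ?thesis
    using assms by (auto intro: DERIV_unique)
qed

lemma integral_periodic_derivative:
  fixes y :: "real \<Rightarrow> real"
  assumes "\<And>t. (y has_real_derivative y' t) (at t)" "y T = y 0" "0 \<le> T"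
  shows "(y' has_integral 0) {0..T}"
proof -
  have "(y' has_integral y T - y 0) {0..T}"
    using assms
    by (intro fundamental_theorem_of_calculus)
       (auto simp: has_real_derivative_iff_has_vector_derivative[symmetric]
             intro: has_field_derivative_at_within)
  then show ?thesis using assms by simp
qed

text \<open>By the intermediate value theorem some \<open>a\<close> has
  \<open>y a = y (a + T / 2)\<close>. Subtracting this value gives zeros half a period apart, so the
  Dirichlet inequality applies on both halves with the right constant. As \<open>y\<close> has mean
  zero, subtracting a constant can only increase the square integral.\<close>

lemma wirtinger_periodic:
  fixes y y' :: "real \<Rightarrow> real"
  assumes T: "0 < T"
    and y: "\<And>t. (y has_real_derivative y' t) (at t)"
    and y': "continuous_on UNIV y'"
    and per: "\<And>t. y (t + T) = y t"
    and mean: "integral {0..T} y = 0"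
  shows "(2 * pi / T)\<^sup>2 * integral {0..T} (\<lambda>t. (y t)\<^sup>2) \<le> integral {0..T} (\<lambda>t. (y' t)\<^sup>2)"
proof -
  have cy: "continuous_on UNIV y"
    using y by (meson DERIV_isCont continuous_at_imp_continuous_on)
  define H where "H = T / 2"
  have H: "0 < H" "T = 2 * H" using T by (auto simp: H_def)
  obtain a where a: "0 \<le> a" "a \<le> H" "y a = y (a + H)"
  proof -
    define d where "d t = y (t + H) - y t" for t
    have cd: "continuous_on {0..H} d"
      unfolding d_def by (intro continuous_intros continuous_on_compose2[OF cy]) auto
    have "d H = - d 0" using per[of 0] H by (simp add: d_def)
    then have "d 0 \<le> 0 \<and> 0 \<le> d H \<or> d H \<le> 0 \<and> 0 \<le> d 0" by linarith
    then obtain a where "0 \<le> a" "a \<le> H" "d a = 0"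
      using IVT'[OF _ _ _ cd, of 0] IVT2'[OF _ _ _ cd, of 0] H by (metis less_imp_le)
    then show ?thesis using that by (simp add: d_def)
  qed
  have aT: "a \<le> T" using a H by simp
  define c where "c = y a"
  define w where "w t = y t - c" for t
  have dw: "(w has_real_derivative y' t) (at t)" for t
    unfolding w_def using y by (auto intro!: derivative_eq_intros)
  have cw: "continuous_on UNIV w" unfolding w_def by (intro continuous_intros cy)
  have intw: "(\<lambda>t. (w t)\<^sup>2) integrable_on {x..z}" for x z
    by (intro integrable_continuous_real continuous_intros continuous_on_subset[OF cw]) auto
  have inty': "(\<lambda>t. (y' t)\<^sup>2) integrable_on {x..z}" for x z
    by (intro integrable_continuous_real continuous_intros continuous_on_subset[OF y']) auto
  have inty: "y integrable_on {x..z}" "(\<lambda>t. (y t)\<^sup>2) integrable_on {x..z}" for x z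
    by (intro integrable_continuous_real continuous_intros continuous_on_subset[OF cy]; simp)+
  have w0: "w a = 0" "w (a + H) = 0" "w (a + T) = 0"
    using a per[of a] by (auto simp: w_def c_def)
  have y'p: "y' (t + T) = y' t" for t
    by (rule periodic_derivative[OF y per])
  have "(pi / H)\<^sup>2 * integral {a..a + H} (\<lambda>t. (w t)\<^sup>2) \<le> integral {a..a + H} (\<lambda>t. (y' t)\<^sup>2)"
    using wirtinger_dirichlet[of a "a + H" w y'] H w0 dw continuous_on_subset[OF y'] by auto
  moreover have "(pi / H)\<^sup>2 * integral {a + H..a + T} (\<lambda>t. (w t)\<^sup>2) \<le> integral {a + H..a + T} (\<lambda>t. (y' t)\<^sup>2)"
    using wirtinger_dirichlet[of "a + H" "a + T" w y'] H w0 dw continuous_on_subset[OF y'] by auto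
  moreover have "integral {a..a + H} f + integral {a + H..a + T} f = integral {a..a + T} f"
    if "\<And>x z. f integrable_on {x..z}" for f :: "real \<Rightarrow> real"
    using H that by (intro Henstock_Kurzweil_Integration.integral_combine) auto
  ultimately have "(pi / H)\<^sup>2 * integral {a..a + T} (\<lambda>t. (w t)\<^sup>2) \<le> integral {a..a + T} (\<lambda>t. (y' t)\<^sup>2)"
    using intw inty' by (smt (verit, best) distrib_left)
  also have "integral {a..a + T} (\<lambda>t. (w t)\<^sup>2) = integral {0..T} (\<lambda>t. (w t)\<^sup>2)"
    using a aT by (intro integral_periodic_shift continuous_intros cw) (simp_all add: w_def per flip: H(2))
  also have "integral {a..a + T} (\<lambda>t. (y' t)\<^sup>2) = integral {0..T} (\<lambda>t. (y' t)\<^sup>2)"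
    using a aT by (intro integral_periodic_shift continuous_intros y') (simp_all add: y'p flip: H(2))
  also have "pi / H = 2 * pi / T" using H by simp
  finally have 1: "(2 * pi / T)\<^sup>2 * integral {0..T} (\<lambda>t. (w t)\<^sup>2) \<le> integral {0..T} (\<lambda>t. (y' t)\<^sup>2)" .
  have "integral {0..T} (\<lambda>t. (w t)\<^sup>2) = integral {0..T} (\<lambda>t. (y t)\<^sup>2 + (c\<^sup>2 - 2 * c * y t))"
    by (simp add: w_def power2_eq_square algebra_simps)
  also have "\<dots> = integral {0..T} (\<lambda>t. (y t)\<^sup>2) + T * c\<^sup>2"
  proof -
    have "((\<lambda>t. (y t)\<^sup>2 + (c\<^sup>2 - 2 * c * y t)) has_integral
        integral {0..T} (\<lambda>t. (y t)\<^sup>2) + ((T - 0) * c\<^sup>2 - 2 * c * integral {0..T} y)) {0..T}"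
      using inty T has_integral_const_real[of "c\<^sup>2" 0 T]
      by (intro has_integral_add has_integral_diff has_integral_mult_right integrable_integral) auto
    then show ?thesis by (simp add: integral_unique mean)
  qed
  finally have "integral {0..T} (\<lambda>t. (y t)\<^sup>2) \<le> integral {0..T} (\<lambda>t. (w t)\<^sup>2)"
    using T by simp
  then have "(2 * pi / T)\<^sup>2 * integral {0..T} (\<lambda>t. (y t)\<^sup>2) \<le> (2 * pi / T)\<^sup>2 * integral {0..T} (\<lambda>t. (w t)\<^sup>2)"
    by (intro mult_left_mono) auto
  then show ?thesis using 1 by linarith
qed

section \<open>A quadratic form for fields on the circle\<close>

text \<open>The two squares are the radial and tangential components of the angular derivative of
  the field (\<open>P\<close>, \<open>Q\<close>), weighted as in the cone inequality;
  \<open>P * Q' - Q * P'\<close> is the density of twice the signed area enclosed by the image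
  curve. Nonnegativity of the integral is the growth inequality for \<open>h\<close>.\<close>

definition circle_form :: "real \<Rightarrow> real \<Rightarrow> real \<Rightarrow> real \<Rightarrow> real \<Rightarrow> real \<Rightarrow> real \<Rightarrow> real \<Rightarrow> real"
  where "circle_form \<alpha> \<beta> \<gamma> t P Q P' Q' =
    \<beta> * (P' * cos t + Q' * sin t)\<^sup>2 + \<gamma> * (- P' * sin t + Q' * cos t)\<^sup>2 + \<alpha> * (P * Q' - Q * P')"

text \<open>The frame only changes sign when t increases by pi, so the quadratic form is the same at
  both points and the parallelogram law applies. It separates the parts of a field that are even and
  odd under the antipodal map.\<close>

lemma circle_form_parallelogram:
  "circle_form \<alpha> \<beta> \<gamma> t P Q P' Q' + circle_form \<alpha> \<beta> \<gamma> (t + pi) R S R' S'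
   = 2 * circle_form \<alpha> \<beta> \<gamma> t ((P + R) / 2) ((Q + S) / 2) ((P' + R') / 2) ((Q' + S') / 2)
   + 2 * circle_form \<alpha> \<beta> \<gamma> t ((P - R) / 2) ((Q - S) / 2) ((P' - R') / 2) ((Q' - S') / 2)"
  unfolding circle_form_def sin_periodic_pi cos_periodic_pi
  by (simp add: field_simps power2_eq_square)

text \<open>The squares dominate \<alpha>/2 times the full squared derivative. Young's inequality
  spends half of this on the area term, and the Wirtinger inequality for period pi makes the other
  half absorb the resulting zeroth-order terms.\<close>

lemma circle_form_even:
  fixes P Q P' Q' :: "real \<Rightarrow> real"
  assumes par: "0 < \<alpha>" "\<alpha> \<le> 2 * \<gamma>" "\<gamma> \<le> \<beta>"
    and dP: "\<And>t. (P has_real_derivative P' t) (at t)" and dQ: "\<And>t. (Q has_real_derivative Q' t) (at t)"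
    and cP': "continuous_on UNIV P'" and cQ': "continuous_on UNIV Q'"
    and per: "\<And>t. P (t + pi) = P t" "\<And>t. Q (t + pi) = Q t"
  shows "0 \<le> integral {0..pi} (\<lambda>t. circle_form \<alpha> \<beta> \<gamma> t (P t) (Q t) (P' t) (Q' t))"
proof -
  have cP: "continuous_on UNIV P" and cQ: "continuous_on UNIV Q"
    using dP dQ by (meson DERIV_isCont continuous_at_imp_continuous_on)+
  note cont = continuous_on_subset[OF cP subset_UNIV] continuous_on_subset[OF cQ subset_UNIV]
    continuous_on_subset[OF cP' subset_UNIV] continuous_on_subset[OF cQ' subset_UNIV]
  define mP mQ where "mP = integral {0..pi} P / pi" and "mQ = integral {0..pi} Q / pi"
  define X Y where "X t = P t - mP" and "Y t = Q t - mQ" for t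
  have W: "4 * integral {0..pi} (\<lambda>t. (X t)\<^sup>2) \<le> integral {0..pi} (\<lambda>t. (P' t)\<^sup>2)"
  proof -
    have "(X has_real_derivative P' t) (at t)" for t
      unfolding X_def by (auto intro!: derivative_eq_intros dP)
    moreover have "integral {0..pi} X = 0"
      using has_integral_diff[OF integrable_integral[OF integrable_continuous_real[OF cont(1), of 0 pi]]
          has_integral_const_real[of mP 0 pi]]
      by (simp add: X_def[abs_def] mP_def integral_unique)
    moreover have "X (t + pi) = X t" for t by (simp add: X_def per)
    ultimately show ?thesis
      using wirtinger_periodic[of pi X P'] cP' by simp
  qed
  have W': "4 * integral {0..pi} (\<lambda>t. (Y t)\<^sup>2) \<le> integral {0..pi} (\<lambda>t. (Q' t)\<^sup>2)"
  proof -
    have "(Y has_real_derivative Q' t) (at t)" for t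
      unfolding Y_def by (auto intro!: derivative_eq_intros dQ)
    moreover have "integral {0..pi} Y = 0"
      using has_integral_diff[OF integrable_integral[OF integrable_continuous_real[OF cont(2), of 0 pi]]
          has_integral_const_real[of mQ 0 pi]]
      by (simp add: Y_def[abs_def] mQ_def integral_unique)
    moreover have "Y (t + pi) = Y t" for t by (simp add: Y_def per)
    ultimately show ?thesis
      using wirtinger_periodic[of pi Y Q'] cQ' by simp
  qed
  have i: "(\<lambda>t. (X t)\<^sup>2) integrable_on {0..pi}" "(\<lambda>t. (Y t)\<^sup>2) integrable_on {0..pi}"
     "(\<lambda>t. (P' t)\<^sup>2) integrable_on {0..pi}" "(\<lambda>t. (Q' t)\<^sup>2) integrable_on {0..pi}"
     "(\<lambda>t. circle_form \<alpha> \<beta> \<gamma> t (P t) (Q t) (P' t) (Q' t)) integrable_on {0..pi}"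
    unfolding X_def Y_def circle_form_def
    by (intro integrable_continuous_real continuous_intros cont)+
  have z: "(P' has_integral 0) {0..pi}" "(Q' has_integral 0) {0..pi}"
    using integral_periodic_derivative[of P P' pi] integral_periodic_derivative[of Q Q' pi] dP dQ
      per(1)[of 0] per(2)[of 0] by auto
  \<comment> \<open>A minorant of the form: two Wirtinger deficits, plus derivatives stemming from
    the means \<open>mP\<close> and \<open>mQ\<close> that integrate to zero.\<close>
  define L where "L t = (\<alpha> / 4) * ((P' t)\<^sup>2 - 4 * (X t)\<^sup>2) + (\<alpha> / 4) * ((Q' t)\<^sup>2 - 4 * (Y t)\<^sup>2)
    + (\<alpha> * mP) * Q' t - (\<alpha> * mQ) * P' t" for t
  have "(L has_integral (\<alpha> / 4) * (integral {0..pi} (\<lambda>t. (P' t)\<^sup>2) - 4 * integral {0..pi} (\<lambda>t. (X t)\<^sup>2))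
     + (\<alpha> / 4) * (integral {0..pi} (\<lambda>t. (Q' t)\<^sup>2) - 4 * integral {0..pi} (\<lambda>t. (Y t)\<^sup>2))
     + (\<alpha> * mP) * 0 - (\<alpha> * mQ) * 0) {0..pi}"
    unfolding L_def using i z
    by (intro has_integral_add has_integral_diff has_integral_mult_right integrable_integral)
  moreover have "0 \<le> (\<alpha> / 4) * (integral {0..pi} (\<lambda>t. (P' t)\<^sup>2) - 4 * integral {0..pi} (\<lambda>t. (X t)\<^sup>2))
     + (\<alpha> / 4) * (integral {0..pi} (\<lambda>t. (Q' t)\<^sup>2) - 4 * integral {0..pi} (\<lambda>t. (Y t)\<^sup>2))
     + (\<alpha> * mP) * 0 - (\<alpha> * mQ) * 0"
    using W W' par by simp
  ultimately have "0 \<le> integral {0..pi} L" "L integrable_on {0..pi}"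
    by (auto simp: integral_unique)
  moreover have "integral {0..pi} L \<le> integral {0..pi} (\<lambda>t. circle_form \<alpha> \<beta> \<gamma> t (P t) (Q t) (P' t) (Q' t))"
  proof (rule integral_le)
    fix t
    define b c where "b = P' t * cos t + Q' t * sin t" and "c = - P' t * sin t + Q' t * cos t"
    have bc: "b\<^sup>2 + c\<^sup>2 = (P' t)\<^sup>2 + (Q' t)\<^sup>2"
    proof -
      have "b\<^sup>2 + c\<^sup>2 = ((P' t)\<^sup>2 + (Q' t)\<^sup>2) * ((sin t)\<^sup>2 + (cos t)\<^sup>2)"
        unfolding b_def c_def by algebra
      then show ?thesis by simp
    qed
    have "\<alpha> / 2 * (b\<^sup>2 + c\<^sup>2) \<le> \<gamma> * (b\<^sup>2 + c\<^sup>2)"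
      using par by (intro mult_right_mono) auto
    also have "\<dots> \<le> \<beta> * b\<^sup>2 + \<gamma> * c\<^sup>2"
      using mult_right_mono[OF par(3), of "b\<^sup>2"] by (simp add: algebra_simps)
    finally have 1: "\<alpha> / 2 * ((P' t)\<^sup>2 + (Q' t)\<^sup>2) \<le> \<beta> * b\<^sup>2 + \<gamma> * c\<^sup>2"
      unfolding bc .
    have "0 \<le> (X t + Q' t / 2)\<^sup>2 + (Y t - P' t / 2)\<^sup>2" by simp
    then have "- ((X t)\<^sup>2 + (Y t)\<^sup>2 + ((P' t)\<^sup>2 + (Q' t)\<^sup>2) / 4) \<le> X t * Q' t - Y t * P' t"
      by (simp add: power2_eq_square field_simps)
    then have "\<alpha> * (- ((X t)\<^sup>2 + (Y t)\<^sup>2 + ((P' t)\<^sup>2 + (Q' t)\<^sup>2) / 4)) \<le> \<alpha> * (X t * Q' t - Y t * P' t)"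
      using par by (intro mult_left_mono) auto
    with 1 show "L t \<le> circle_form \<alpha> \<beta> \<gamma> t (P t) (Q t) (P' t) (Q' t)"
      unfolding L_def circle_form_def b_def[symmetric] c_def[symmetric] X_def Y_def
      by (simp add: algebra_simps add_divide_distrib)
  qed (use i calculation in auto)
  ultimately show ?thesis by linarith
qed

text \<open>In the rotating frame the even modes give a form with constant coefficients, which is
  nonnegative modulo divergences once \<open>|k| \<ge> 2\<close>; the exponent is the one for which the mode
  \<open>|k| = 2\<close> becomes degenerate, and there the form is a sum of squares plus the Wirtinger deficit of \<open>p\<close>.\<close>

lemma circle_form_odd:
  fixes P Q P' Q' :: "real \<Rightarrow> real"
  assumes par: "0 < \<alpha>" "0 < \<beta>" "0 < \<gamma>" "\<alpha> * (\<alpha> + \<beta> + \<gamma>) = 3 * \<beta> * \<gamma>"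
    and dP: "\<And>t. (P has_real_derivative P' t) (at t)" and dQ: "\<And>t. (Q has_real_derivative Q' t) (at t)"
    and cP': "continuous_on UNIV P'" and cQ': "continuous_on UNIV Q'"
    and per: "\<And>t. P (t + pi) = - P t" "\<And>t. Q (t + pi) = - Q t"
  shows "0 \<le> integral {0..pi} (\<lambda>t. circle_form \<alpha> \<beta> \<gamma> t (P t) (Q t) (P' t) (Q' t))"
proof -
  have cP: "continuous_on UNIV P" and cQ: "continuous_on UNIV Q"
    using dP dQ by (meson DERIV_isCont continuous_at_imp_continuous_on)+
  note cont = continuous_on_subset[OF cP subset_UNIV] continuous_on_subset[OF cQ subset_UNIV]
    continuous_on_subset[OF cP' subset_UNIV] continuous_on_subset[OF cQ' subset_UNIV]
  define S where "S = \<alpha> + \<beta> + \<gamma>"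
  have S: "0 < S" "\<alpha> = S - \<beta> - \<gamma>" using par by (auto simp: S_def)
  \<comment> \<open>Chosen so that \<gamma> x = \<alpha> + \<gamma> and \<beta> y = \<alpha> +
    \<beta>; the relation between the parameters then says \<open>x * y = 4\<close>. The two squares
    below vanish together when \<open>q' = - x * X\<close> and \<open>p' = y * q\<close>, formally
    p'' = - 4 X, the second mode. The weight \<omega> is what completing the square in
    \<open>p'\<close> leaves of \<beta>.\<close>
  define x y where "x = (3 * \<beta> + S) / S" and "y = (3 * \<gamma> + S) / S"
  define \<omega> where "\<omega> = 3 * \<beta> * (\<alpha> + \<gamma>) / (4 * S)"
  have y0: "0 < y" using par S by (simp add: y_def)
  have w0: "0 < \<omega>" using par S by (simp add: \<omega>_def)
  have aS: "\<alpha> * S = 3 * \<beta> * \<gamma>" using par by (simp add: S_def)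
  have xS: "x * S = 3 * \<beta> + S" and yS: "y * S = 3 * \<gamma> + S" using S by (auto simp: x_def y_def)
  have gx: "\<gamma> * x = \<alpha> + \<gamma>"
  proof -
    have "\<gamma> * x * S = \<gamma> * (3 * \<beta> + S)" using xS by (simp add: mult.assoc)
    also have "\<dots> = (\<alpha> + \<gamma>) * S" using aS by (simp add: algebra_simps)
    finally show ?thesis using S by simp
  qed
  have bey: "\<beta> * y = \<alpha> + \<beta>"
  proof -
    have "\<beta> * y * S = \<beta> * (3 * \<gamma> + S)" using yS by (simp add: mult.assoc)
    also have "\<dots> = (\<alpha> + \<beta>) * S" using aS by (simp add: algebra_simps)
    finally show ?thesis using S by simp
  qed
  have xy: "x * y = 4"
  proof -
    have "x * y * (S * S) = (3 * \<beta> + S) * (3 * \<gamma> + S)" using xS yS by (metis mult.commute mult.left_commute)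
    also have "\<dots> = 3 * (\<alpha> * S) + 3 * S * (\<beta> + \<gamma>) + S * S" using aS by (simp add: algebra_simps)
    also have "\<dots> = 4 * (S * S)" unfolding S(2) by (simp add: algebra_simps)
    finally show ?thesis using S by simp
  qed
  have omega: "4 * \<omega> = 3 * \<beta> * (\<alpha> + \<gamma>) / S" "\<beta> / y + \<omega> = \<beta>"
  proof -
    show "4 * \<omega> = 3 * \<beta> * (\<alpha> + \<gamma>) / S" by (simp add: \<omega>_def)
    have "1 / y = x / 4" using xy y0 by (simp add: field_simps)
    then have "\<beta> / y = \<beta> * (x / 4)" by (metis mult.right_neutral times_divide_eq_right)
    also have "\<dots> = \<beta> * (3 * \<beta> + S) / (4 * S)" using S by (simp add: x_def)
    also have "\<dots> + \<omega> = \<beta> * (3 * \<beta> + S + 3 * (\<alpha> + \<gamma>)) / (4 * S)"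
      by (simp add: \<omega>_def add_divide_distrib[symmetric] algebra_simps)
    also have "\<dots> = \<beta> * (4 * S) / (4 * S)" unfolding S(2) by (simp add: algebra_simps)
    finally show "\<beta> / y + \<omega> = \<beta>" using S by simp
  qed
  \<comment> \<open>Components in the rotating frame. Frame and field both change sign under a shift
    by pi, so \<open>p\<close> and \<open>q\<close> have period pi.\<close>
  define p q where "p t = P t * cos t + Q t * sin t" and "q t = - P t * sin t + Q t * cos t" for t
  define p' q' where "p' t = P' t * cos t + Q' t * sin t + q t"
    and "q' t = - P' t * sin t + Q' t * cos t - p t" for t
  have dp: "(p has_real_derivative p' t) (at t)" and dq: "(q has_real_derivative q' t) (at t)" for t
    unfolding p_def p'_def q_def q'_def
    by (auto intro!: derivative_eq_intros dP dQ simp: algebra_simps)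
  have cp: "continuous_on A p" and cq: "continuous_on A q" for A
    unfolding p_def q_def by (intro continuous_intros cont)+
  have cp': "continuous_on A p'" and cq': "continuous_on A q'" for A
    unfolding p'_def q'_def by (intro continuous_intros cont cp cq)+
  have pp: "p (t + pi) = p t" and qp: "q (t + pi) = q t" for t
    by (auto simp: p_def q_def per)
  define m where "m = integral {0..pi} p / pi"
  define X where "X t = p t - m" for t
  have cX: "continuous_on A X" for A unfolding X_def by (intro continuous_intros cp)
  have dX: "(X has_real_derivative p' t) (at t)" for t
    unfolding X_def by (auto intro!: derivative_eq_intros dp)
  have X0: "(X has_integral 0) {0..pi}"
    using has_integral_diff[OF integrable_integral[OF integrable_continuous_real[OF cp, of 0 pi]]
        has_integral_const_real[of m 0 pi]]
    by (simp add: X_def[abs_def] m_def)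
  have W: "4 * integral {0..pi} (\<lambda>t. (X t)\<^sup>2) \<le> integral {0..pi} (\<lambda>t. (p' t)\<^sup>2)"
    using wirtinger_periodic[of pi X p'] dX cp' pp X0
    by (auto simp: X_def[of "_ + _"] integral_unique) (auto simp: X_def)
  have z1: "(q' has_integral 0) {0..pi}"
    using integral_periodic_derivative[of q q' pi] dq qp[of 0] by auto
  have z2: "((\<lambda>t. X t * q' t + p' t * q t) has_integral 0) {0..pi}"
    using qp[of 0] pp[of 0]
    by (intro integral_periodic_derivative[of "\<lambda>t. X t * q t"])
       (auto intro!: derivative_eq_intros dX dq, simp add: X_def)
  have i: "(\<lambda>t. (X t)\<^sup>2) integrable_on {0..pi}" "(\<lambda>t. (p' t)\<^sup>2) integrable_on {0..pi}"
     "(\<lambda>t. circle_form \<alpha> \<beta> \<gamma> t (P t) (Q t) (P' t) (Q' t)) integrable_on {0..pi}"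
    unfolding circle_form_def
    by (intro integrable_continuous_real continuous_intros cont cX cp')+
  \<comment> \<open>The Wirtinger deficit of \<open>p\<close>, plus terms of integral zero: the
    derivative of \<open>X * q\<close>, and the linear terms created by the mean
    \<open>m\<close>.\<close>
  define L where "L t = \<omega> * ((p' t)\<^sup>2 - 4 * (X t)\<^sup>2) - \<alpha> * (X t * q' t + p' t * q t)
     + (2 * (\<alpha> + \<gamma>) * m) * X t + ((2 * \<gamma> + \<alpha>) * m) * q' t" for t
  have "(L has_integral \<omega> * (integral {0..pi} (\<lambda>t. (p' t)\<^sup>2) - 4 * integral {0..pi} (\<lambda>t. (X t)\<^sup>2))
     - \<alpha> * 0 + (2 * (\<alpha> + \<gamma>) * m) * 0 + ((2 * \<gamma> + \<alpha>) * m) * 0) {0..pi}"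
    unfolding L_def using i z1 z2 X0
    by (intro has_integral_add has_integral_diff has_integral_mult_right integrable_integral)
  moreover have "0 \<le> \<omega> * (integral {0..pi} (\<lambda>t. (p' t)\<^sup>2) - 4 * integral {0..pi} (\<lambda>t. (X t)\<^sup>2))"
    using W w0 by simp
  ultimately have "0 \<le> integral {0..pi} L" "L integrable_on {0..pi}"
    by (auto simp: integral_unique)
  moreover have "integral {0..pi} L \<le> integral {0..pi} (\<lambda>t. circle_form \<alpha> \<beta> \<gamma> t (P t) (Q t) (P' t) (Q' t))"
  proof (rule integral_le)
    fix t
    have "P t * Q' t - Q t * P' t = (P t * Q' t - Q t * P' t) * ((sin t)\<^sup>2 + (cos t)\<^sup>2)" by simp
    also have "\<dots> = p t * (q' t + p t) - q t * (p' t - q t)"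
      unfolding p_def q_def p'_def q'_def by algebra
    finally have "circle_form \<alpha> \<beta> \<gamma> t (P t) (Q t) (P' t) (Q' t)
      = \<beta> * (p' t - q t)\<^sup>2 + \<gamma> * (q' t + p t)\<^sup>2 + \<alpha> * (p t * (q' t + p t) - q t * (p' t - q t))"
      by (simp add: circle_form_def p'_def q'_def)
    also have "\<dots> = L t + \<gamma> * (q' t + x * X t)\<^sup>2 + (\<beta> / y) * (p' t - y * q t)\<^sup>2 + (\<alpha> + \<gamma>) * m\<^sup>2"
    proof -
      have e1: "\<gamma> * (q' t + x * X t)\<^sup>2 = \<gamma> * (q' t)\<^sup>2 + 2 * (\<gamma> * x) * q' t * X t + (\<gamma> * x) * x * (X t)\<^sup>2"
        by (simp add: power2_eq_square algebra_simps)
      have e2: "(\<beta> / y) * (p' t - y * q t)\<^sup>2 = (\<beta> / y) * (p' t)\<^sup>2 - 2 * \<beta> * p' t * q t + \<beta> * y * (q t)\<^sup>2"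
        using y0 by (simp add: power2_eq_square field_simps)
      have e3: "(\<beta> / y) = \<beta> - \<omega>" using omega by simp
      have e4: "(\<gamma> * x) * x - 4 * \<omega> = \<alpha> + \<gamma>"
      proof -
        have "(\<gamma> * x) * x = (\<alpha> + \<gamma>) * (3 * \<beta> + S) / S" unfolding gx by (simp add: x_def)
        then show ?thesis unfolding omega using S(1) by (simp add: field_simps)
      qed
      have e5: "\<omega> * 4 = (\<gamma> * x) * x - \<alpha> - \<gamma>" using e4 by simp
      have pX: "p t = X t + m" by (simp add: X_def)
      have L: "L t = \<omega> * (p' t)\<^sup>2 - ((\<gamma> * x) * x - \<alpha> - \<gamma>) * (X t)\<^sup>2 - \<alpha> * (X t * q' t + p' t * q t)
     + (2 * (\<alpha> + \<gamma>) * m) * X t + ((2 * \<gamma> + \<alpha>) * m) * q' t"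
        unfolding L_def e5[symmetric] by (simp add: algebra_simps)
      show ?thesis
        unfolding L e1 e2 unfolding bey e3 pX unfolding gx
        by (simp add: power2_eq_square algebra_simps)
    qed
    finally show "L t \<le> circle_form \<alpha> \<beta> \<gamma> t (P t) (Q t) (P' t) (Q' t)"
      using par y0 by simp
  qed (use i calculation in auto)
  ultimately show ?thesis by linarith
qed

lemma circle_form_nonneg:
  fixes P Q P' Q' :: "real \<Rightarrow> real"
  assumes par: "0 < \<alpha>" "0 < \<gamma>" "\<gamma> \<le> \<beta>" "\<beta> \<le> 2 * \<gamma>" "\<alpha> * (\<alpha> + \<beta> + \<gamma>) = 3 * \<beta> * \<gamma>"
    and dP: "\<And>t. (P has_real_derivative P' t) (at t)" and dQ: "\<And>t. (Q has_real_derivative Q' t) (at t)"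
    and cP': "continuous_on UNIV P'" and cQ': "continuous_on UNIV Q'"
    and per: "\<And>t. P (t + 2 * pi) = P t" "\<And>t. Q (t + 2 * pi) = Q t"
  shows "0 \<le> integral {0..2 * pi} (\<lambda>t. circle_form \<alpha> \<beta> \<gamma> t (P t) (Q t) (P' t) (Q' t))"
proof -
  have cP: "continuous_on UNIV P" and cQ: "continuous_on UNIV Q"
    using dP dQ by (meson DERIV_isCont continuous_at_imp_continuous_on)+
  note cont = continuous_on_subset[OF cP subset_UNIV] continuous_on_subset[OF cQ subset_UNIV]
    continuous_on_subset[OF cP' subset_UNIV] continuous_on_subset[OF cQ' subset_UNIV]
  note contp = continuous_on_compose2[OF cP] continuous_on_compose2[OF cQ]
    continuous_on_compose2[OF cP'] continuous_on_compose2[OF cQ']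
  \<comment> \<open>The even case needs this bound; a larger \<alpha> would push
    \<open>\<alpha> * (\<alpha> + \<beta> + \<gamma>)\<close> above
    \<open>3 * \<beta> * \<gamma>\<close>.\<close>
  have a2: "\<alpha> \<le> 2 * \<gamma>"
  proof (rule ccontr)
    assume "\<not> \<alpha> \<le> 2 * \<gamma>"
    then have "2 * \<gamma> * (2 * \<gamma> + \<beta> + \<gamma>) < \<alpha> * (\<alpha> + \<beta> + \<gamma>)"
      using par by (intro mult_strict_mono) auto
    moreover have "\<beta> * \<gamma> \<le> 2 * \<gamma> * \<gamma>" using par by (intro mult_right_mono) auto
    ultimately show False using par by (simp add: algebra_simps)
  qed
  define E where "E t = circle_form \<alpha> \<beta> \<gamma> t (P t) (Q t) (P' t) (Q' t)" for t
  have cE: "continuous_on A E" for A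
    unfolding E_def circle_form_def by (intro continuous_intros cont)
  define ev od where "ev f t = (f t + f (t + pi)) / 2" and "od f t = (f t - f (t + pi)) / 2"
    for f :: "real \<Rightarrow> real" and t
  have dshift: "((\<lambda>t. f (t + pi)) has_real_derivative f' (t + pi)) (at t)"
    if "\<And>t. (f has_real_derivative f' t) (at t)" for f f' :: "real \<Rightarrow> real" and t
    using that[of "t + pi"] by (simp only: DERIV_shift)
  have d: "(ev f has_real_derivative ev f' t) (at t)" "(od f has_real_derivative od f' t) (at t)"
    if "\<And>t. (f has_real_derivative f' t) (at t)" for f f' and t
    using that dshift[of f f' t] by (auto intro!: derivative_eq_intros simp: ev_def[abs_def] od_def[abs_def])
  have c: "continuous_on A (ev f)" "continuous_on A (od f)" if "continuous_on UNIV f" for f and A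
    unfolding ev_def od_def
    by (intro continuous_intros continuous_on_compose2[OF that] continuous_on_subset[OF that]; simp)+
  have p: "ev f (t + pi) = ev f t" "od f (t + pi) = - od f t" if "\<And>t. f (t + 2 * pi) = f t" for f t
    using that[of t] by (auto simp: ev_def od_def add.assoc field_simps)
  have 1: "0 \<le> integral {0..pi} (\<lambda>t. circle_form \<alpha> \<beta> \<gamma> t (ev P t) (ev Q t) (ev P' t) (ev Q' t))"
    using par a2 dP dQ cP' cQ' per by (intro circle_form_even d c p)
  have 2: "0 \<le> integral {0..pi} (\<lambda>t. circle_form \<alpha> \<beta> \<gamma> t (od P t) (od Q t) (od P' t) (od Q' t))"
    using par dP dQ cP' cQ' per by (intro circle_form_odd d c p) auto
  have i: "(\<lambda>t. circle_form \<alpha> \<beta> \<gamma> t (ev P t) (ev Q t) (ev P' t) (ev Q' t)) integrable_on {0..pi}"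
    "(\<lambda>t. circle_form \<alpha> \<beta> \<gamma> t (od P t) (od Q t) (od P' t) (od Q' t)) integrable_on {0..pi}"
    unfolding circle_form_def
    by (intro integrable_continuous_real continuous_intros c cP cQ cP' cQ')+
  have iE: "E integrable_on {a..b}" for a b by (intro integrable_continuous_real cE)
  have iE': "(\<lambda>t. E (t + pi)) integrable_on {0..pi}"
    by (intro integrable_continuous_real continuous_on_compose2[OF cE[of UNIV]] continuous_intros) auto
  have "integral {0..2 * pi} E = integral {0..pi} E + integral {pi..2 * pi} E"
    using iE by (intro Henstock_Kurzweil_Integration.integral_combine[symmetric]) auto
  also have "integral {pi..2 * pi} E = integral {0..pi} (\<lambda>t. E (t + pi))"
    using integral_shift[of 0 pi pi E] cE by (simp add: o_def)
  also have "integral {0..pi} E + integral {0..pi} (\<lambda>t. E (t + pi)) = integral {0..pi} (\<lambda>t. E t + E (t + pi))"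
    using iE iE' by (simp add: integral_add)
  also have "(\<lambda>t. E t + E (t + pi)) = (\<lambda>t. 2 * circle_form \<alpha> \<beta> \<gamma> t (ev P t) (ev Q t) (ev P' t) (ev Q' t)
      + 2 * circle_form \<alpha> \<beta> \<gamma> t (od P t) (od Q t) (od P' t) (od Q' t))"
    unfolding E_def circle_form_parallelogram ev_def od_def ..
  also have "integral {0..pi} \<dots> = 2 * integral {0..pi} (\<lambda>t. circle_form \<alpha> \<beta> \<gamma> t (ev P t) (ev Q t) (ev P' t) (ev Q' t))
      + 2 * integral {0..pi} (\<lambda>t. circle_form \<alpha> \<beta> \<gamma> t (od P t) (od Q t) (od P' t) (od Q' t))"
    using i by (subst integral_add) (auto intro!: integrable_on_mult_right)
  finally show ?thesis using 1 2 unfolding E_def by linarith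
qed

section \<open>Elliptic cones and polar coordinates\<close>

lemma norm_matrix_vector_mult_le:
  fixes A :: "real^'n^'m"
  shows "norm (A *v x) \<le> norm A * norm x"
proof -
  have "norm (A *v x) = L2_set (\<lambda>i. norm (A $ i \<bullet> x)) UNIV"
    by (simp add: norm_vec_def matrix_mult_dot)
  also have "\<dots> \<le> L2_set (\<lambda>i. norm (A $ i) * norm x) UNIV"
    by (intro L2_set_mono) (auto simp: Cauchy_Schwarz_ineq2)
  also have "\<dots> = norm A * norm x"
    by (simp add: norm_vec_def L2_set_left_distrib)
  finally show ?thesis .
qed

text \<open>The symmetric matrices whose eigenvalues \<open>e\<^sub>1 > 0 > e\<^sub>2\<close> satisfy \<open>1/K \<le> -e\<^sub>2/e\<^sub>1 \<le> K\<close>, and \<open>0\<close>.\<close>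

definition elliptic_cone :: "real \<Rightarrow> real^2^2 \<Rightarrow> bool"
  where "elliptic_cone K A \<longleftrightarrow> A $ 1 $ 2 = A $ 2 $ 1 \<and> K * (trace A)\<^sup>2 \<le> (K - 1)\<^sup>2 * (- det A)"

lemma elliptic_cone_scaleR:
  assumes "elliptic_cone K A"
  shows "elliptic_cone K (c *\<^sub>R A)"
proof -
  have "c\<^sup>2 * (K * (trace A)\<^sup>2) \<le> c\<^sup>2 * ((K - 1)\<^sup>2 * (- det A))"
    using assms by (intro mult_left_mono) (auto simp: elliptic_cone_def)
  then show ?thesis
    using assms by (simp add: elliptic_cone_def trace_def det_2 sum_2 power2_eq_square algebra_simps)
qed

text \<open>\<open>K\<close> times the slack of the cone condition plus
  \<open>(K * a + c)\<^sup>2\<close> has the factor \<open>K - 1\<close>, and the cofactor is the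
  claim up to scaling. Equality occurs on the boundary of the cone when c = - K a. For
  \<open>K = 1\<close> the factor is lost, but then the cone forces a = - c.\<close>

lemma cone_inequality:
  fixes a b c K :: real
  assumes K: "1 \<le> K" and cone: "K * (a + c)\<^sup>2 \<le> (K - 1)\<^sup>2 * (b\<^sup>2 - a * c)"
  shows "2 / (K + 1) * b\<^sup>2 + 1 / K * c\<^sup>2 \<le> b\<^sup>2 - a * c"
proof (cases "K = 1")
  case True
  then have "a = - c" using cone by simp
  then show ?thesis using True by (simp add: power2_eq_square)
next
  case False
  then have K1: "K > 1" using K by simp
  have "0 \<le> K * ((K - 1)\<^sup>2 * (b\<^sup>2 - a * c) - K * (a + c)\<^sup>2) + (K * a + c)\<^sup>2"
    using cone K by simp
  also have "\<dots> = (K - 1) * (K * (K + 1) * (b\<^sup>2 - a * c) - (2 * K * b\<^sup>2 + (K + 1) * c\<^sup>2))"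
    by (simp add: power2_eq_square algebra_simps)
  finally have "2 * K * b\<^sup>2 + (K + 1) * c\<^sup>2 \<le> K * (K + 1) * (b\<^sup>2 - a * c)"
    using K1 by (simp add: zero_le_mult_iff)
  then have "(2 * K * b\<^sup>2 + (K + 1) * c\<^sup>2) / (K * (K + 1)) \<le> b\<^sup>2 - a * c"
    using K1 by (subst pos_divide_le_eq) (auto simp: mult.commute)
  also have "(2 * K * b\<^sup>2 + (K + 1) * c\<^sup>2) / (K * (K + 1)) = 2 / (K + 1) * b\<^sup>2 + 1 / K * c\<^sup>2"
    using K1 by (simp add: add_divide_distrib)
  finally show ?thesis .
qed

text \<open>The distortion inequality of quasiregular maps, with Jacobian of reversed sign; it
  follows because 1/K \<le> 2/(K + 1).\<close>

lemma cone_inequality':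
  fixes a b c K :: real
  assumes K: "1 \<le> K" and cone: "K * (a + c)\<^sup>2 \<le> (K - 1)\<^sup>2 * (b\<^sup>2 - a * c)"
  shows "b\<^sup>2 + c\<^sup>2 \<le> K * (b\<^sup>2 - a * c)"
proof -
  have "1 / K * b\<^sup>2 \<le> 2 / (K + 1) * b\<^sup>2"
    using K by (intro mult_right_mono) (auto simp: field_simps)
  then have "(b\<^sup>2 + c\<^sup>2) / K \<le> b\<^sup>2 - a * c"
    using cone_inequality[OF assms] by (simp add: add_divide_distrib)
  then show ?thesis using K by (simp add: field_simps)
qed

section \<open>The rotating frame and fields in polar coordinates\<close>

definition dir :: "real \<Rightarrow> real^2"
  where "dir t = cos t *\<^sub>R axis 1 1 + sin t *\<^sub>R axis 2 1"

definition dir' :: "real \<Rightarrow> real^2"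
  where "dir' t = - sin t *\<^sub>R axis 1 1 + cos t *\<^sub>R axis 2 1"

lemma dir_nth [simp]: "dir t $ 1 = cos t" "dir t $ 2 = sin t" "dir' t $ 1 = - sin t" "dir' t $ 2 = cos t"
  by (auto simp: dir_def dir'_def axis_def)

lemma norm_dir [simp]: "norm (dir t) = 1" "norm (dir' t) = 1"
  by (auto simp: norm_vec_def L2_set_def sum_2)

lemma dir_periodic [simp]: "dir (t + 2 * pi) = dir t" "dir (2 * pi) = dir 0"
  by (auto simp: dir_def)

lemma continuous_on_dir: "continuous_on A dir" "continuous_on A dir'"
  unfolding dir_def dir'_def by (intro continuous_intros)+

lemma has_vector_derivative_dir: "(dir has_vector_derivative dir' t) (at t)"
  unfolding dir_def dir'_def by (auto intro!: derivative_eq_intros)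

lemma exists_dir: "\<exists>t\<ge>0. t \<le> 2 * pi \<and> z = norm z *\<^sub>R dir t"
proof (cases "z = 0")
  case False
  have "(z $ 1 / norm z)\<^sup>2 + (z $ 2 / norm z)\<^sup>2 = ((z $ 1)\<^sup>2 + (z $ 2)\<^sup>2) / (norm z)\<^sup>2"
    by (simp add: power_divide add_divide_distrib)
  also have "(z $ 1)\<^sup>2 + (z $ 2)\<^sup>2 = (norm z)\<^sup>2"
    by (simp add: norm_vec_def L2_set_def sum_2)
  finally have "(z $ 1 / norm z)\<^sup>2 + (z $ 2 / norm z)\<^sup>2 = 1" using False by simp
  then obtain t where t: "0 \<le> t" "t < 2 * pi" "z $ 1 / norm z = cos t" "z $ 2 / norm z = sin t"
    by (rule sincos_total_2pi)
  have "z $ 1 = norm z * cos t" "z $ 2 = norm z * sin t"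
    using False by (simp_all flip: t(3,4))
  then have "z = norm z *\<^sub>R dir t"
    by (simp add: vec_eq_iff forall_2)
  then show ?thesis using t by (intro exI[of _ t]) auto
qed (auto intro!: exI[of _ 0])

text \<open>Here \<open>a\<close>, \<open>b\<close>, \<open>c\<close> are the entries of
  \<open>A\<close> in the frame (\<open>dir t\<close>, \<open>dir' t\<close>), and a rotation
  preserves trace and determinant. The derivative along \<open>dir' t\<close> has components
  \<open>b\<close>, \<open>c\<close>; along \<open>dir t\<close> it has \<open>a\<close>,
  \<open>b\<close>, the same situation with \<open>a\<close> and \<open>c\<close> exchanged.\<close>

lemma elliptic_cone_frame:
  assumes K: "1 \<le> K" and A: "elliptic_cone K A"
  shows "2 / (K + 1) * ((A *v dir' t) $ 1 * cos t + (A *v dir' t) $ 2 * sin t)\<^sup>2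
      + 1 / K * (- (A *v dir' t) $ 1 * sin t + (A *v dir' t) $ 2 * cos t)\<^sup>2 \<le> - det A"
    and "((A *v dir' t) $ 1)\<^sup>2 + ((A *v dir' t) $ 2)\<^sup>2 \<le> K * (- det A)"
    and "((A *v dir t) $ 1)\<^sup>2 + ((A *v dir t) $ 2)\<^sup>2 \<le> K * (- det A)"
    and "(A *v dir t) $ 1 * (A *v dir' t) $ 2 - (A *v dir t) $ 2 * (A *v dir' t) $ 1 = det A"
proof -
  define x y z where xyz: "x = A $ 1 $ 1" "y = A $ 1 $ 2" "z = A $ 2 $ 2"
  have y: "A $ 2 $ 1 = y" using A by (simp add: elliptic_cone_def xyz)
  define C S where CS: "C = cos t" "S = sin t"
  have 1: "C\<^sup>2 + S\<^sup>2 = 1" by (simp add: CS)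
  have comps: "(A *v dir t) $ 1 = x * C + y * S" "(A *v dir t) $ 2 = y * C + z * S"
    "(A *v dir' t) $ 1 = - x * S + y * C" "(A *v dir' t) $ 2 = - y * S + z * C"
    by (simp_all add: matrix_vector_mult_def sum_2 xyz(1,3) y CS flip: xyz(2))
  define a b c where "a = x * C * C + 2 * y * C * S + z * S * S"
    and "b = (- x * S + y * C) * C + (- y * S + z * C) * S"
    and "c = x * S * S - 2 * y * C * S + z * C * C"
  have det: "- det A = y * y - x * z" by (simp add: det_2 y flip: xyz)
  have tr: "trace A = x + z" by (simp add: trace_def sum_2 xyz)
  have "a + c = (x + z) * (C\<^sup>2 + S\<^sup>2)" unfolding a_def c_def by algebra
  then have ac: "a + c = trace A" using 1 tr by simp
  have "b\<^sup>2 - a * c = (y * y - x * z) * (C\<^sup>2 + S\<^sup>2)\<^sup>2" unfolding a_def b_def c_def by (simp add: power2_eq_square algebra_simps)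
  then have bac: "b\<^sup>2 - a * c = - det A" using 1 det by simp
  have cone: "K * (a + c)\<^sup>2 \<le> (K - 1)\<^sup>2 * (b\<^sup>2 - a * c)"
    unfolding ac bac using A by (simp add: elliptic_cone_def)
  have c_eq: "- (- x * S + y * C) * S + (- y * S + z * C) * C = c"
    unfolding c_def by algebra
  show "2 / (K + 1) * ((A *v dir' t) $ 1 * cos t + (A *v dir' t) $ 2 * sin t)\<^sup>2
      + 1 / K * (- (A *v dir' t) $ 1 * sin t + (A *v dir' t) $ 2 * cos t)\<^sup>2 \<le> - det A"
    using cone_inequality[OF K cone]
    unfolding comps CS[symmetric] c_eq bac b_def[symmetric] .
  have "(- x * S + y * C)\<^sup>2 + (- y * S + z * C)\<^sup>2 = ((- x * S + y * C)\<^sup>2 + (- y * S + z * C)\<^sup>2) * (C\<^sup>2 + S\<^sup>2)"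
    using 1 by simp
  also have "\<dots> = b\<^sup>2 + c\<^sup>2" unfolding b_def c_def by algebra
  finally show "((A *v dir' t) $ 1)\<^sup>2 + ((A *v dir' t) $ 2)\<^sup>2 \<le> K * (- det A)"
    using cone_inequality'[OF K cone] unfolding comps bac by simp
  have "(x * C + y * S)\<^sup>2 + (y * C + z * S)\<^sup>2 = ((x * C + y * S)\<^sup>2 + (y * C + z * S)\<^sup>2) * (C\<^sup>2 + S\<^sup>2)"
    using 1 by simp
  also have "\<dots> = b\<^sup>2 + a\<^sup>2" unfolding b_def a_def by algebra
  finally show "((A *v dir t) $ 1)\<^sup>2 + ((A *v dir t) $ 2)\<^sup>2 \<le> K * (- det A)"
    using cone_inequality'[OF K, of c a b] cone bac unfolding comps by (simp add: add.commute mult.commute)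
  have "(x * C + y * S) * (- y * S + z * C) - (y * C + z * S) * (- x * S + y * C) = (x * z - y * y) * (C\<^sup>2 + S\<^sup>2)"
    by algebra
  then show "(A *v dir t) $ 1 * (A *v dir' t) $ 2 - (A *v dir t) $ 2 * (A *v dir' t) $ 1 = det A"
    unfolding comps using 1 det by simp
qed

text \<open>Models the gradient of a multiple of an increment of \<open>u\<close>, with
  \<open>M\<close> as its Hessian. The cone is invariant under scaling, so increments and difference
  quotients are covered alike.\<close>

locale elliptic_field =
  fixes f :: "real^2 \<Rightarrow> real^2" and M :: "real^2 \<Rightarrow> real^2^2" and S :: "(real^2) set" and K :: real
  assumes deriv: "x \<in> S \<Longrightarrow> (f has_derivative (\<lambda>h. M x *v h)) (at x)"
    and cont_M: "continuous_on S M"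
    and cone: "x \<in> S \<Longrightarrow> elliptic_cone K (M x)"
    and K: "1 \<le> K"
begin

lemma cont_f: "continuous_on S f"
  using deriv has_derivative_continuous continuous_at_imp_continuous_on by blast

lemma subset: "T \<subseteq> S \<Longrightarrow> elliptic_field f M T K"
  by unfold_locales (use deriv cont_M cone K continuous_on_subset in blast)+

end

locale polar_field = elliptic_field f M "ball x0 R" K
  for f M x0 R K +
  assumes R: "0 < R"
begin

abbreviation "pt r t \<equiv> x0 + r *\<^sub>R dir t"

definition "P r t = f (pt r t) $ 1"
definition "Q r t = f (pt r t) $ 2"
definition "Pr r t = (M (pt r t) *v dir t) $ 1"
definition "Qr r t = (M (pt r t) *v dir t) $ 2"
definition "Pt r t = r * (M (pt r t) *v dir' t) $ 1"
definition "Qt r t = r * (M (pt r t) *v dir' t) $ 2"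
definition "J r t = - det (M (pt r t))"
text \<open>By Green's formula \<open>h r\<close> is the integral of \<open>- det M\<close> over the ball of radius \<open>r\<close>.\<close>

definition "h r = - (1 / 2) * integral {0..2 * pi} (\<lambda>t. P r t * Qt r t - Q r t * Pt r t)"
definition "h' r = r * integral {0..2 * pi} (J r)"

lemma pt_in: "\<bar>r\<bar> < R \<Longrightarrow> pt r t \<in> ball x0 R"
  by (simp add: dist_norm)

lemma has_derivative_r:
  assumes "\<bar>r\<bar> < R"
  shows "((\<lambda>r. P r t) has_real_derivative Pr r t) (at r)"
    and "((\<lambda>r. Q r t) has_real_derivative Qr r t) (at r)"
proof -
  have "((\<lambda>r. pt r t) has_derivative (\<lambda>h. h *\<^sub>R dir t)) (at r)"
    by (auto intro!: derivative_eq_intros)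
  then have "((\<lambda>r. f (pt r t)) has_derivative (\<lambda>h. M (pt r t) *v (h *\<^sub>R dir t))) (at r)"
    using deriv[OF pt_in[OF assms]] by (rule has_derivative_compose)
  then have *: "((\<lambda>r. f (pt r t) $ i) has_derivative (\<lambda>h. (M (pt r t) *v (h *\<^sub>R dir t)) $ i)) (at r)" for i
    by (rule bounded_linear.has_derivative[OF bounded_linear_vec_nth])
  show "((\<lambda>r. P r t) has_real_derivative Pr r t) (at r)"
    and "((\<lambda>r. Q r t) has_real_derivative Qr r t) (at r)"
    unfolding P_def Q_def Pr_def Qr_def
    by (rule has_derivative_imp_has_field_derivative[OF *]; simp add: matrix_vector_mult_scaleR)+
qed

lemma has_derivative_t:
  assumes "\<bar>r\<bar> < R"
  shows "(P r has_real_derivative Pt r t) (at t)"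
    and "(Q r has_real_derivative Qt r t) (at t)"
proof -
  have "(dir has_derivative (\<lambda>h. h *\<^sub>R dir' t)) (at t)"
    using has_vector_derivative_dir by (simp add: has_vector_derivative_def)
  then have "((\<lambda>t. pt r t) has_derivative (\<lambda>h. r *\<^sub>R h *\<^sub>R dir' t)) (at t)"
    by (auto intro!: derivative_eq_intros)
  then have "((\<lambda>t. f (pt r t)) has_derivative (\<lambda>h. M (pt r t) *v (r *\<^sub>R h *\<^sub>R dir' t))) (at t)"
    using deriv[OF pt_in[OF assms]] by (rule has_derivative_compose)
  then have *: "((\<lambda>t. f (pt r t) $ i) has_derivative (\<lambda>h. (M (pt r t) *v (r *\<^sub>R h *\<^sub>R dir' t)) $ i)) (at t)" for i
    by (rule bounded_linear.has_derivative[OF bounded_linear_vec_nth])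
  show "(P r has_real_derivative Pt r t) (at t)"
    and "(Q r has_real_derivative Qt r t) (at t)"
    unfolding P_def Q_def Pt_def Qt_def
    by (rule has_derivative_imp_has_field_derivative[OF *]; simp add: matrix_vector_mult_scaleR)+
qed

lemma cont_Mt: "\<bar>r\<bar> < R \<Longrightarrow> continuous_on A (\<lambda>t. M (pt r t))"
  by (rule continuous_on_compose2[OF cont_M])
     (auto intro!: continuous_intros continuous_on_dir simp: dist_norm)

lemma continuous_t:
  assumes "\<bar>r\<bar> < R"
  shows "continuous_on A (P r)" "continuous_on A (Q r)" "continuous_on A (Pr r)" "continuous_on A (Qr r)"
    "continuous_on A (Pt r)" "continuous_on A (Qt r)" "continuous_on A (J r)"
proof -
  show "continuous_on A (P r)" "continuous_on A (Q r)"
    using has_derivative_t[OF assms] by (meson DERIV_isCont continuous_at_imp_continuous_on)+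
  have "continuous_on A (\<lambda>t. M (pt r t) $ i $ j)" for i j
    by (intro continuous_intros cont_Mt assms)
  then show "continuous_on A (Pr r)" "continuous_on A (Qr r)"
    "continuous_on A (Pt r)" "continuous_on A (Qt r)" "continuous_on A (J r)"
    unfolding Pr_def Qr_def Pt_def Qt_def J_def matrix_vector_mult_def sum_2 det_2
    by (simp_all add: continuous_intros)
qed

lemma frame:
  assumes "\<bar>r\<bar> < R"
  shows "2 / (K + 1) * (Pt r t * cos t + Qt r t * sin t)\<^sup>2 + 1 / K * (- Pt r t * sin t + Qt r t * cos t)\<^sup>2 \<le> r\<^sup>2 * J r t"
    and "(Pt r t)\<^sup>2 + (Qt r t)\<^sup>2 \<le> r\<^sup>2 * (K * J r t)"
    and "(Pr r t)\<^sup>2 + (Qr r t)\<^sup>2 \<le> K * J r t"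
    and "Pr r t * Qt r t - Qr r t * Pt r t = - r * J r t"
proof -
  note F = elliptic_cone_frame[OF K cone[OF pt_in[OF assms]], of t t]
  show "2 / (K + 1) * (Pt r t * cos t + Qt r t * sin t)\<^sup>2 + 1 / K * (- Pt r t * sin t + Qt r t * cos t)\<^sup>2 \<le> r\<^sup>2 * J r t"
    using mult_left_mono[OF F(1), of "r\<^sup>2"]
    by (simp add: J_def Pt_def Qt_def power2_eq_square algebra_simps)
  show "(Pt r t)\<^sup>2 + (Qt r t)\<^sup>2 \<le> r\<^sup>2 * (K * J r t)"
    using mult_left_mono[OF F(2), of "r\<^sup>2"]
    by (simp add: J_def Pt_def Qt_def power2_eq_square algebra_simps)
  show "(Pr r t)\<^sup>2 + (Qr r t)\<^sup>2 \<le> K * J r t"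
    using F(3) by (simp add: J_def Pr_def Qr_def)
  show "Pr r t * Qt r t - Qr r t * Pt r t = - r * J r t"
    using arg_cong[OF F(4), of "\<lambda>z. r * z"]
    by (simp add: J_def Pt_def Qt_def Pr_def Qr_def algebra_simps)
qed

lemma J_nonneg: "\<bar>r\<bar> < R \<Longrightarrow> 0 \<le> J r t"
proof -
  assume "\<bar>r\<bar> < R"
  then have "0 \<le> K * J r t" using frame(3)[of r t] by (meson order_trans sum_power2_ge_zero)
  then show ?thesis using K by (simp add: zero_le_mult_iff)
qed

end

section \<open>Growth of the Jacobian integral\<close>

text \<open>With \<beta> = 2/(K + 1) and \<gamma> = 1/K the equation reads (\<alpha> +
  \<beta>)(\<alpha> + \<gamma>) = 4 \<beta> \<gamma>, the condition for the second mode to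
  degenerate. The bound \<alpha> \<le> 1 serves to replace factors such as
  \<open>8 powr \<alpha>\<close> by 8.\<close>

definition growth_exponent :: "real \<Rightarrow> real \<Rightarrow> bool"
  where "growth_exponent K \<alpha> \<longleftrightarrow>
    0 < \<alpha> \<and> \<alpha> \<le> 1 \<and> \<alpha> * (\<alpha> + 2 / (K + 1) + 1 / K) = 3 * (2 / (K + 1)) * (1 / K)"

context polar_field
begin

lemma bounded_on_cball:
  assumes "\<rho> < R"
  obtains B where "0 \<le> B" "\<And>x. x \<in> cball x0 \<rho> \<Longrightarrow> norm (M x) \<le> B"
    "\<And>x y. x \<in> cball x0 \<rho> \<Longrightarrow> y \<in> cball x0 \<rho> \<Longrightarrow> norm (f x - f y) \<le> B * norm (x - y)"
proof -
  have sub: "cball x0 \<rho> \<subseteq> ball x0 R" using assms by auto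
  have "bounded (M ` cball x0 \<rho>)"
    by (intro compact_imp_bounded compact_continuous_image continuous_on_subset[OF cont_M] sub) auto
  then obtain B where B: "0 < B" "\<And>x. x \<in> cball x0 \<rho> \<Longrightarrow> norm (M x) \<le> B"
    by (auto simp: bounded_pos)
  have on: "onorm (\<lambda>h. M x *v h) \<le> B" if "x \<in> cball x0 \<rho>" for x
  proof (rule onorm_bound)
    show "norm (M x *v h) \<le> B * norm h" for h
      using norm_matrix_vector_mult_le[of "M x" h] mult_right_mono[OF B(2)[OF that], of "norm h"] by simp
  qed (use B in simp)
  have "norm (f x - f y) \<le> B * norm (x - y)" if "x \<in> cball x0 \<rho>" "y \<in> cball x0 \<rho>" for x y
    using that on sub
    by (intro differentiable_bound[of "cball x0 \<rho>" f "\<lambda>x h. M x *v h" B x y])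
       (auto intro!: has_derivative_at_withinI deriv)
  with B show ?thesis using that[of B] by auto
qed

text \<open>Polarisation: the bilinear form behind \<open>h\<close> is symmetric up to the
  derivative \<open>Z\<close> of a periodic function, so B(F, F) - B(G, G) = B(F - G, F + G). In
  this shape the radial increment is not differentiated in the angle.\<close>

lemma h_diff:
  assumes "\<bar>r\<bar> < R" "\<bar>s\<bar> < R"
  shows "h s - h r = - (1 / 2) * integral {0..2 * pi}
    (\<lambda>t. (P s t - P r t) * (Qt s t + Qt r t) - (Q s t - Q r t) * (Pt s t + Pt r t))"
proof -
  define Z where "Z t = Pt s t * Q r t + P s t * Qt r t - (Pt r t * Q s t + P r t * Qt s t)" for t
  have Z: "(Z has_integral 0) {0..2 * pi}"
    by (rule integral_periodic_derivative[of "\<lambda>t. P s t * Q r t - P r t * Q s t"])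
       (auto simp: Z_def P_def[of _ "2 * pi"] Q_def[of _ "2 * pi"] P_def[of _ 0] Q_def[of _ 0]
          intro!: derivative_eq_intros has_derivative_t assms)
  have i: "(\<lambda>t. P q t * Qt q t - Q q t * Pt q t) integrable_on {0..2 * pi}" if "\<bar>q\<bar> < R" for q
    by (intro integrable_continuous_real continuous_intros continuous_t that)
  have "((\<lambda>t. (P s t * Qt s t - Q s t * Pt s t) - (P r t * Qt r t - Q r t * Pt r t) + Z t) has_integral
     integral {0..2 * pi} (\<lambda>t. P s t * Qt s t - Q s t * Pt s t)
     - integral {0..2 * pi} (\<lambda>t. P r t * Qt r t - Q r t * Pt r t) + 0) {0..2 * pi}"
    by (intro has_integral_add has_integral_diff integrable_integral i assms Z)
  also have "(\<lambda>t. (P s t * Qt s t - Q s t * Pt s t) - (P r t * Qt r t - Q r t * Pt r t) + Z t)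
    = (\<lambda>t. (P s t - P r t) * (Qt s t + Qt r t) - (Q s t - Q r t) * (Pt s t + Pt r t))"
    by (auto simp: Z_def algebra_simps)
  finally show ?thesis by (simp add: h_def integral_unique algebra_simps)
qed

text \<open>The field is only \<open>C\<^sup>1\<close>, so the integrand of \<open>h\<close> is not differentiable in \<open>r\<close>; integrating by
  parts along the circle moves the angular derivative off the increment of the field.\<close>

lemma h_has_derivative:
  assumes r: "\<bar>r\<bar> < R"
  shows "(h has_real_derivative h' r) (at r)"
proof -
  \<comment> \<open>An intermediate radius: on the compact ball of radius \<rho> the derivative
    \<open>M\<close> is bounded and \<open>f\<close> is Lipschitz, which dominates the
    integrands.\<close>
  define \<rho> where "\<rho> = (\<bar>r\<bar> + R) / 2"
  have \<rho>: "\<bar>r\<bar> < \<rho>" "\<rho> < R" "0 < \<rho>" using r by (auto simp: \<rho>_def)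
  obtain B where B: "0 \<le> B" "\<And>x. x \<in> cball x0 \<rho> \<Longrightarrow> norm (M x) \<le> B"
    "\<And>x y. x \<in> cball x0 \<rho> \<Longrightarrow> y \<in> cball x0 \<rho> \<Longrightarrow> norm (f x - f y) \<le> B * norm (x - y)"
    using bounded_on_cball[OF \<rho>(2)] by blast
  have ptc: "pt s t \<in> cball x0 \<rho>" if "\<bar>s\<bar> < \<rho>" for s t using that by (simp add: dist_norm)
  have lip: "\<bar>P s t - P r t\<bar> \<le> B * \<bar>s - r\<bar>" "\<bar>Q s t - Q r t\<bar> \<le> B * \<bar>s - r\<bar>" if "\<bar>s\<bar> < \<rho>" for s t
  proof -
    have "norm (f (pt s t) - f (pt r t)) \<le> B * \<bar>s - r\<bar>"
      using B(3)[OF ptc[OF that] ptc[OF \<rho>(1)], of t t] by (simp flip: scaleR_diff_left)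
    then have "\<bar>(f (pt s t) - f (pt r t)) $ i\<bar> \<le> B * \<bar>s - r\<bar>" for i
      by (rule order_trans[OF component_le_norm_cart])
    from this[of 1] this[of 2]
    show "\<bar>P s t - P r t\<bar> \<le> B * \<bar>s - r\<bar>" "\<bar>Q s t - Q r t\<bar> \<le> B * \<bar>s - r\<bar>"
      by (simp_all add: P_def Q_def)
  qed
  have bt: "\<bar>Pt s t\<bar> \<le> \<rho> * B" "\<bar>Qt s t\<bar> \<le> \<rho> * B" if "\<bar>s\<bar> < \<rho>" for s t
  proof -
    have "\<bar>(M (pt s t) *v dir' t) $ i\<bar> \<le> B" for i
      using component_le_norm_cart[of "M (pt s t) *v dir' t" i]
        norm_matrix_vector_mult_le[of "M (pt s t)" "dir' t"] B(2)[OF ptc[OF that, of t]] by simp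
    then show "\<bar>Pt s t\<bar> \<le> \<rho> * B" "\<bar>Qt s t\<bar> \<le> \<rho> * B"
      using that B by (auto simp: Pt_def Qt_def abs_mult intro!: mult_mono)
  qed
  have "((\<lambda>s. (h s - h r) / (s - r)) \<longlongrightarrow> h' r) (at r within {- \<rho><..<\<rho>})"
    unfolding tendsto_at_iff_sequentially
  proof (intro allI impI)
    fix s assume s: "\<forall>i. s i \<in> {- \<rho><..<\<rho>} - {r}" and lim: "s \<longlonglongrightarrow> r"
    have si: "\<bar>s i\<bar> < \<rho>" "\<bar>s i\<bar> < R" "s i \<noteq> r" for i using s[rule_format, of i] \<rho> by auto
    define k where "k n t = (P (s n) t - P r t) / (s n - r) * (Qt (s n) t + Qt r t)
       - (Q (s n) t - Q r t) / (s n - r) * (Pt (s n) t + Pt r t)" for n t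
    have filt: "filterlim s (at r) sequentially"
      using lim si by (auto simp: filterlim_at)
    have eq: "((\<lambda>s. (h s - h r) / (s - r)) \<circ> s) n = - (1 / 2) * integral {0..2 * pi} (k n)" for n
    proof -
      define w where "w t = (P (s n) t - P r t) * (Qt (s n) t + Qt r t) - (Q (s n) t - Q r t) * (Pt (s n) t + Pt r t)" for t
      have kn: "k n = (\<lambda>t. inverse (s n - r) * w t)"
      proof
        have *: "A / c * X - B / c * Y = inverse c * (A * X - B * Y)" for A B c X Y :: real
          by (simp add: divide_inverse algebra_simps)
        show "k n t = inverse (s n - r) * w t" for t
          unfolding k_def w_def * ..
      qed
      have "integral {0..2 * pi} (k n) = inverse (s n - r) * integral {0..2 * pi} w"
        unfolding kn by (rule integral_mult_right)
      moreover have "h (s n) - h r = - (1 / 2) * integral {0..2 * pi} w"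
        unfolding w_def by (rule h_diff[OF r si(2)])
      ultimately show ?thesis
        by (simp only: o_def divide_inverse mult_ac)
    qed
    have "(\<lambda>n. integral {0..2 * pi} (k n)) \<longlonglongrightarrow> integral {0..2 * pi} (\<lambda>t. Pr r t * (Qt r t + Qt r t) - Qr r t * (Pt r t + Pt r t))"
    proof (rule dominated_convergence(2))
      show "k n integrable_on {0..2 * pi}" for n
        unfolding k_def
        using si[of n] r by (intro integrable_continuous_real continuous_intros continuous_t) auto
      show "(\<lambda>_. B * (\<rho> * B + \<rho> * B) + B * (\<rho> * B + \<rho> * B)) integrable_on {0..2 * pi}"
        by (rule integrable_const_ivl)
      show "norm (k n t) \<le> B * (\<rho> * B + \<rho> * B) + B * (\<rho> * B + \<rho> * B)" for n t
      proof -
        have q: "\<bar>(P (s n) t - P r t) / (s n - r)\<bar> \<le> B" "\<bar>(Q (s n) t - Q r t) / (s n - r)\<bar> \<le> B"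
          using lip[OF si(1), of n t] si(3)[of n] by (auto simp: abs_divide divide_le_eq)
        have w: "\<bar>Qt (s n) t + Qt r t\<bar> \<le> \<rho> * B + \<rho> * B" "\<bar>Pt (s n) t + Pt r t\<bar> \<le> \<rho> * B + \<rho> * B"
          using bt[OF si(1), of n t] bt[OF \<rho>(1), of t] by linarith+
        have "norm (k n t) \<le> \<bar>(P (s n) t - P r t) / (s n - r) * (Qt (s n) t + Qt r t)\<bar>
            + \<bar>(Q (s n) t - Q r t) / (s n - r) * (Pt (s n) t + Pt r t)\<bar>"
          unfolding k_def real_norm_def by (rule abs_triangle_ineq4)
        also have "\<dots> \<le> B * (\<rho> * B + \<rho> * B) + B * (\<rho> * B + \<rho> * B)"
          unfolding abs_mult by (intro add_mono mult_mono q w B) auto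
        finally show ?thesis .
      qed
      fix t
      have q: "((\<lambda>s. (P s t - P r t) / (s - r)) \<longlongrightarrow> Pr r t) (at r)" "((\<lambda>s. (Q s t - Q r t) / (s - r)) \<longlongrightarrow> Qr r t) (at r)"
        using has_derivative_r[OF r, of t] by (simp_all add: has_field_derivative_iff)
      note 1 = filterlim_compose[OF q(1) filt] filterlim_compose[OF q(2) filt]
      have "isCont M (pt r t)"
        using cont_M pt_in[OF r] by (simp add: continuous_on_eq_continuous_at)
      moreover have "(\<lambda>n. pt (s n) t) \<longlonglongrightarrow> pt r t" by (intro tendsto_intros lim)
      ultimately have "(\<lambda>n. M (pt (s n) t)) \<longlonglongrightarrow> M (pt r t)"
        by (rule isCont_tendsto_compose)
      then have "(\<lambda>n. Pt (s n) t) \<longlonglongrightarrow> Pt r t" "(\<lambda>n. Qt (s n) t) \<longlonglongrightarrow> Qt r t"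
        unfolding Pt_def Qt_def matrix_vector_mult_def sum_2
        by (intro tendsto_intros lim; assumption)+
      with 1 show "(\<lambda>n. k n t) \<longlonglongrightarrow> Pr r t * (Qt r t + Qt r t) - Qr r t * (Pt r t + Pt r t)"
        unfolding k_def by (intro tendsto_intros)
    qed
    also have "(\<lambda>t. Pr r t * (Qt r t + Qt r t) - Qr r t * (Pt r t + Pt r t)) = (\<lambda>t. (- 2 * r) * J r t)"
    proof
      fix t
      have "Pr r t * (Qt r t + Qt r t) - Qr r t * (Pt r t + Pt r t) = 2 * (Pr r t * Qt r t - Qr r t * Pt r t)"
        by (simp add: algebra_simps)
      then show "Pr r t * (Qt r t + Qt r t) - Qr r t * (Pt r t + Pt r t) = (- 2 * r) * J r t"
        unfolding frame(4)[OF r] by simp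
    qed
    finally have "(\<lambda>n. - (1 / 2) * integral {0..2 * pi} (k n)) \<longlonglongrightarrow> - (1 / 2) * ((- 2 * r) * integral {0..2 * pi} (J r))"
      by (intro tendsto_intros) simp
    moreover have "(\<lambda>s. (h s - h r) / (s - r)) \<circ> s = (\<lambda>n. - (1 / 2) * integral {0..2 * pi} (k n))"
      by (rule ext) (rule eq)
    ultimately show "((\<lambda>s. (h s - h r) / (s - r)) \<circ> s) \<longlonglongrightarrow> h' r"
      by (simp add: h'_def)
  qed
  then show ?thesis
    using \<rho> by (simp add: has_field_derivative_iff at_within_open[of r "{- \<rho><..<\<rho>}"] abs_less_iff)
qed

lemma integral_J_nonneg: "\<bar>r\<bar> < R \<Longrightarrow> 0 \<le> integral {0..2 * pi} (J r)"
  by (intro integral_nonneg integrable_continuous_real continuous_t) (auto simp: J_nonneg)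

lemma h'_nonneg: "0 \<le> r \<Longrightarrow> r < R \<Longrightarrow> 0 \<le> h' r"
  by (simp add: h'_def integral_J_nonneg)

lemma h_0: "h 0 = 0"
  by (simp add: h_def Pt_def Qt_def)

lemma h_mono: "0 \<le> r \<Longrightarrow> r \<le> s \<Longrightarrow> s < R \<Longrightarrow> h r \<le> h s"
  by (rule DERIV_nonneg_imp_nondecreasing[of r s h])
     (auto intro!: exI[of _ "h' _"] h_has_derivative h'_nonneg)

lemma h_nonneg: "0 \<le> r \<Longrightarrow> r < R \<Longrightarrow> 0 \<le> h r"
  using h_mono[of 0 r] h_0 by simp

text \<open>\<open>r * h' r\<close> is the integral of \<open>r\<^sup>2 * J r t\<close>, bounded
  below by the two squares of \<open>circle_form\<close> through the cone inequality; the area term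
  of the form integrates to \<open>- 2 * \<alpha> * h r\<close>.\<close>

lemma h_growth_ineq:
  assumes \<alpha>: "growth_exponent K \<alpha>" and r: "0 \<le> r" "r < R"
  shows "2 * \<alpha> * h r \<le> r * h' r"
proof -
  have r': "\<bar>r\<bar> < R" using r by simp
  have per: "P r (t + 2 * pi) = P r t" "Q r (t + 2 * pi) = Q r t" for t
    by (simp_all add: P_def Q_def)
  have "1 / K \<le> 2 / (K + 1)" "2 / (K + 1) \<le> 2 * (1 / K)" using K by (auto simp: field_simps)
  then have "0 \<le> integral {0..2 * pi} (\<lambda>t. circle_form \<alpha> (2 / (K + 1)) (1 / K) t (P r t) (Q r t) (Pt r t) (Qt r t))"
    using \<alpha> K has_derivative_t[OF r'] continuous_t[OF r'] per
    by (intro circle_form_nonneg) (auto simp: growth_exponent_def)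
  also have "\<dots> \<le> integral {0..2 * pi} (\<lambda>t. r\<^sup>2 * J r t + \<alpha> * (P r t * Qt r t - Q r t * Pt r t))"
    using frame(1)[OF r'] K
    by (intro integral_le integrable_continuous_real)
       (auto simp: circle_form_def intro!: continuous_intros continuous_t r')
  also have "\<dots> = r\<^sup>2 * integral {0..2 * pi} (J r) + \<alpha> * integral {0..2 * pi} (\<lambda>t. P r t * Qt r t - Q r t * Pt r t)"
    by (subst integral_add) (auto intro!: integrable_continuous_real continuous_intros continuous_t r')
  also have "\<dots> = r * h' r - 2 * \<alpha> * h r"
    by (simp add: h'_def h_def power2_eq_square)
  finally show ?thesis by simp
qed

lemma h_growth:
  assumes \<alpha>: "growth_exponent K \<alpha>" and r: "0 < r" "r \<le> \<rho>" "\<rho> < R"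
  shows "h r \<le> h \<rho> * (r / \<rho>) powr (2 * \<alpha>)"
proof -
  \<comment> \<open>The growth inequality states that this function is nondecreasing on positive
    radii.\<close>
  define g where "g s = h s * s powr (- 2 * \<alpha>)" for s
  have "g r \<le> g \<rho>"
  proof (rule DERIV_nonneg_imp_nondecreasing[OF r(2)])
    fix s assume s: "r \<le> s" "s \<le> \<rho>"
    define D where "D = h' s * s powr (- 2 * \<alpha>) + h s * (- 2 * \<alpha> * s powr (- 2 * \<alpha> - 1))"
    have "(g has_real_derivative D) (at s)"
      unfolding g_def D_def using s r
      by (auto intro!: derivative_eq_intros h_has_derivative simp: powr_diff)
    moreover have "D = (s * h' s - 2 * \<alpha> * h s) * s powr (- 2 * \<alpha> - 1)"
      using s r by (simp add: D_def powr_diff algebra_simps)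
    ultimately show "\<exists>y. (g has_real_derivative y) (at s) \<and> 0 \<le> y"
      using h_growth_ineq[OF \<alpha>, of s] s r by auto
  qed
  then have "h r * r powr (- 2 * \<alpha>) * r powr (2 * \<alpha>) \<le> h \<rho> * \<rho> powr (- 2 * \<alpha>) * r powr (2 * \<alpha>)"
    unfolding g_def by (intro mult_right_mono) auto
  moreover have "(r / \<rho>) powr (2 * \<alpha>) = \<rho> powr (- 2 * \<alpha>) * r powr (2 * \<alpha>)"
    using r by (subst powr_divide) (auto simp: powr_minus_divide)
  ultimately show ?thesis
    using r by (simp add: mult.assoc flip: powr_add)
qed

text \<open>A Caccioppoli inequality on a single circle: Young's inequality with weight
  \<open>s\<close> is applied to the area term. The choice of \<open>s\<close> makes the
  zeroth-order part equal to \<open>h r\<close>, half of the left side, so that it can be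
  absorbed.\<close>

lemma h_caccioppoli:
  assumes N: "0 < N" "\<And>x. x \<in> ball x0 R \<Longrightarrow> norm (f x) \<le> N" and r: "0 < r" "r < R"
  shows "(h r)\<^sup>2 \<le> pi * N\<^sup>2 * K / 2 * (r * h' r)"
proof (cases "h r = 0")
  case True
  then show ?thesis using N r K h'_nonneg[of r] by simp
next
  case False
  then have hp: "0 < h r" using h_nonneg[of r] r by simp
  have r': "\<bar>r\<bar> < R" using r by simp
  define s where "s = h r / (pi * N\<^sup>2)"
  have s: "0 < s" using hp N by (simp add: s_def)
  have "2 * h r = integral {0..2 * pi} (\<lambda>t. - (P r t * Qt r t - Q r t * Pt r t))"
    unfolding h_def integral_neg by simp
  also have "\<dots> \<le> integral {0..2 * pi} (\<lambda>t. s * N\<^sup>2 / 2 + r\<^sup>2 * K / (2 * s) * J r t)"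
  proof (rule integral_le)
    fix t
    have "(P r t)\<^sup>2 + (Q r t)\<^sup>2 = (norm (f (pt r t)))\<^sup>2"
      by (simp add: P_def Q_def norm_vec_def L2_set_def sum_2)
    also have "\<dots> \<le> N\<^sup>2" using N(2)[OF pt_in[OF r'], of t] by (intro power_mono) auto
    finally have "s * ((P r t)\<^sup>2 + (Q r t)\<^sup>2) \<le> s * N\<^sup>2" using s by (intro mult_left_mono) auto
    moreover have "((Pt r t)\<^sup>2 + (Qt r t)\<^sup>2) / s \<le> (r\<^sup>2 * (K * J r t)) / s"
      using frame(2)[OF r', of t] s by (intro divide_right_mono) auto
    moreover have "- (P r t * Qt r t - Q r t * Pt r t) \<le> (s * ((P r t)\<^sup>2 + (Q r t)\<^sup>2) + ((Pt r t)\<^sup>2 + (Qt r t)\<^sup>2) / s) / 2"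
    proof -
      have "0 \<le> ((s * P r t + Qt r t)\<^sup>2 + (s * Q r t - Pt r t)\<^sup>2) / (2 * s)" using s by simp
      also have "\<dots> = (s * ((P r t)\<^sup>2 + (Q r t)\<^sup>2) + ((Pt r t)\<^sup>2 + (Qt r t)\<^sup>2) / s) / 2 + (P r t * Qt r t - Q r t * Pt r t)"
        using s by (simp add: power2_eq_square field_simps)
      finally show ?thesis by linarith
    qed
    moreover have "r\<^sup>2 * K / (2 * s) * J r t = (r\<^sup>2 * (K * J r t)) / s / 2" by simp
    moreover have "z \<le> U / 2 + V'" if "u \<le> U" "v \<le> V" "z \<le> (u + v) / 2" "V' = V / 2" for u v z U V V' :: real
      using that by simp
    ultimately show "- (P r t * Qt r t - Q r t * Pt r t) \<le> s * N\<^sup>2 / 2 + r\<^sup>2 * K / (2 * s) * J r t"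
      by blast
  qed (use s in \<open>auto intro!: integrable_continuous_real continuous_intros continuous_t r'\<close>)
  also have "\<dots> = pi * s * N\<^sup>2 + r * K * h' r / (2 * s)"
    using s by (subst integral_add)
       (auto intro!: integrable_continuous_real continuous_intros continuous_t r' simp: h'_def power2_eq_square)
  also have "pi * s * N\<^sup>2 = h r" using N by (simp add: s_def)
  finally have "h r \<le> r * K * h' r / (2 * s)" by simp
  then have "h r * (2 * s) \<le> r * K * h' r" using s by (simp add: field_simps)
  then show ?thesis using N by (simp add: s_def power2_eq_square field_simps)
qed

text \<open>The quadratic differential inequality makes \<open>inverse (h r) + ln r / C\<close>
  nonincreasing. Over one doubling of the radius this bounds \<open>h \<rho>\<close> independently
  of the value at the outer radius; ln 2 \<ge> 1/2 gives the constant.\<close>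

lemma h_bound:
  assumes N: "0 < N" "\<And>x. x \<in> ball x0 R \<Longrightarrow> norm (f x) \<le> N" and \<rho>: "0 < \<rho>" "2 * \<rho> < R"
  shows "h \<rho> \<le> pi * N\<^sup>2 * K"
proof (cases "h \<rho> = 0")
  case True
  then show ?thesis using N K by simp
next
  case False
  then have hp: "0 < h \<rho>" using h_nonneg[of \<rho>] \<rho> by simp
  define C where "C = pi * N\<^sup>2 * K / 2"
  have C: "0 < C" using N K by (simp add: C_def)
  define g where "g r = inverse (h r) + ln r / C" for r
  have hr: "0 < h r" if "\<rho> \<le> r" "r \<le> 2 * \<rho>" for r
    using h_mono[of \<rho> r] hp that \<rho> by simp
  have "g (2 * \<rho>) \<le> g \<rho>"
  proof (rule DERIV_nonpos_imp_nonincreasing[of \<rho> "2 * \<rho>" g])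
    fix r assume r: "\<rho> \<le> r" "r \<le> 2 * \<rho>"
    have "(g has_real_derivative 1 / (r * C) - h' r / (h r)\<^sup>2) (at r)"
      unfolding g_def using r \<rho> hr[OF r] C
      by (auto intro!: derivative_eq_intros h_has_derivative simp: power2_eq_square field_simps)
    moreover have "1 / (r * C) - h' r / (h r)\<^sup>2 \<le> 0"
    proof -
      have "(h r)\<^sup>2 \<le> C * (r * h' r)"
        unfolding C_def using h_caccioppoli[OF N, of r] r \<rho> by simp
      then show ?thesis using r \<rho> hr[OF r] C by (simp add: field_simps)
    qed
    ultimately show "\<exists>y. (g has_real_derivative y) (at r) \<and> y \<le> 0" by blast
  qed (use \<rho> in simp)
  then have "ln 2 / C \<le> inverse (h \<rho>) - inverse (h (2 * \<rho>))"
    using \<rho> by (simp add: g_def ln_mult add_divide_distrib)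
  moreover have "1 / 2 \<le> ln (2 :: real)" using ln2_ge_two_thirds by linarith
  then have "1 / 2 / C \<le> ln 2 / C" using C by (intro divide_right_mono) auto
  ultimately have "1 / (2 * C) \<le> inverse (h \<rho>)"
    using positive_imp_inverse_positive[OF hr[of "2 * \<rho>"]] \<rho> by linarith
  then have "h \<rho> \<le> 2 * C" using hp C by (simp add: field_simps)
  then show ?thesis by (simp add: C_def)
qed

end

section \<open>Circle means, oscillation on circles, and good radii\<close>

context polar_field
begin

text \<open>The circle integral \<open>m\<close> is compared with an explicit majorant
  \<open>G\<close> satisfying |m'| \<le> G'. A generic \<open>F\<close> stands for either component
  of the field.\<close>

lemma radial_average:
  assumes \<alpha>: "growth_exponent K \<alpha>" and B: "0 < B" and \<rho>: "\<rho> < R"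
    and hB: "\<And>r. 0 < r \<Longrightarrow> r \<le> \<rho> \<Longrightarrow> h r \<le> B\<^sup>2 * r powr (2 * \<alpha>)"
    and F: "\<And>r t. \<bar>r\<bar> < R \<Longrightarrow> ((\<lambda>r. F r t) has_real_derivative Fr r t) (at r)"
    and cF: "\<And>r. \<bar>r\<bar> < R \<Longrightarrow> continuous_on {0..2 * pi} (F r)"
    and cFr: "continuous_on ({- R<..<R} \<times> cbox 0 (2 * pi)) (\<lambda>(r, t). Fr r t)"
    and bd: "\<And>r t. \<bar>r\<bar> < R \<Longrightarrow> (Fr r t)\<^sup>2 \<le> K * J r t"
    and F0: "\<And>t. F 0 t = c"
    and r: "0 < r" "r \<le> \<rho>"
  shows "\<bar>integral {0..2 * pi} (F r) - 2 * pi * c\<bar> \<le> (K + pi / \<alpha>) * B * r powr \<alpha>"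
proof -
  have \<alpha>0: "0 < \<alpha>" using \<alpha> by (simp add: growth_exponent_def)
  define m where "m r = integral {0..2 * pi} (F r)" for r
  define m' where "m' r = integral {0..2 * pi} (Fr r)" for r
  have dm: "(m has_real_derivative m' r) (at r)" if "\<bar>r\<bar> < R" for r
  proof -
    have "((\<lambda>r. integral (cbox 0 (2 * pi)) (F r)) has_field_derivative integral (cbox 0 (2 * pi)) (Fr r))
        (at r within {- R<..<R})"
    proof (rule leibniz_rule_field_derivative)
      show "((\<lambda>x. F x t) has_field_derivative Fr x t) (at x within {- R<..<R})" if "x \<in> {- R<..<R}" for x t
        using F[of x t] that by (auto intro: has_field_derivative_at_within)
      show "F x integrable_on cbox 0 (2 * pi)" if "x \<in> {- R<..<R}" for x
        using cF[of x] that by (auto intro!: integrable_continuous_real)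
    qed (use that cFr in \<open>auto simp: abs_less_iff\<close>)
    then show ?thesis
      using that at_within_open[of r "{- R<..<R}"] by (simp add: m_def[abs_def] m'_def abs_less_iff)
  qed
  \<comment> \<open>Young's inequality bounds |m'| by \<open>(K / B) * (h' r * r powr (- \<alpha>) /
    2) + pi * B * r powr (\<alpha> - 1)\<close>. By the growth inequality the derivative of
    \<open>h r * r powr (- \<alpha>)\<close> is at least half of
    \<open>h' r * r powr (- \<alpha>)\<close>; integrating both terms gives
    \<open>G\<close>.\<close>
  define G where "G r = (K / B) * (h r * r powr (- \<alpha>)) + (pi * B / \<alpha>) * r powr \<alpha>" for r
  define G' where "G' r = (K / B) * (h' r * r powr (- \<alpha>) - \<alpha> * h r * r powr (- \<alpha> - 1)) + pi * B * r powr (\<alpha> - 1)" for r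
  have dG: "(G has_real_derivative G' r) (at r)" if "0 < r" "r < R" for r
  proof -
    have "((\<lambda>r. h r * r powr (- \<alpha>)) has_real_derivative
        h' r * r powr (- \<alpha>) - \<alpha> * h r * r powr (- \<alpha> - 1)) (at r)"
      using that by (auto intro!: derivative_eq_intros h_has_derivative simp: powr_diff)
    moreover have "((\<lambda>r. (pi * B / \<alpha>) * r powr \<alpha>) has_real_derivative pi * B * r powr (\<alpha> - 1)) (at r)"
      using that \<alpha>0 by (auto intro!: derivative_eq_intros simp: powr_diff)
    ultimately show ?thesis
      unfolding G_def G'_def by (intro DERIV_add DERIV_cmult)
  qed
  have m'G': "\<bar>m' r\<bar> \<le> G' r" if r: "0 < r" "r < R" for r
  proof -
    define s where "s = r powr (1 - \<alpha>) / B"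
    have s: "0 < s" using r B by (simp add: s_def)
    have r': "\<bar>r\<bar> < R" using r by simp
    have sub: "(\<lambda>t. (r, t)) ` {0..2 * pi} \<subseteq> {- R<..<R} \<times> cbox 0 (2 * pi)"
      using r' by (auto simp: abs_less_iff)
    have cFr': "continuous_on {0..2 * pi} (Fr r)"
      using continuous_on_compose2[OF cFr continuous_on_Pair[OF continuous_on_const continuous_on_id] sub]
      by simp
    have "\<bar>m' r\<bar> \<le> integral {0..2 * pi} (\<lambda>t. s * K / 2 * J r t + 1 / (2 * s))"
      unfolding m'_def real_norm_def[symmetric]
    proof (rule integral_norm_bound_integral)
      fix t
      have "0 \<le> (s * \<bar>Fr r t\<bar> - 1)\<^sup>2 / (2 * s)" using s by simp
      also have "\<dots> = s / 2 * (Fr r t)\<^sup>2 + 1 / (2 * s) - \<bar>Fr r t\<bar>"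
        using s by (simp add: power2_eq_square field_simps)
      finally have "\<bar>Fr r t\<bar> \<le> s / 2 * (Fr r t)\<^sup>2 + 1 / (2 * s)" by simp
      also have "s / 2 * (Fr r t)\<^sup>2 \<le> s / 2 * (K * J r t)"
        using bd[OF r', of t] s by (intro mult_left_mono) auto
      finally show "norm (Fr r t) \<le> s * K / 2 * J r t + 1 / (2 * s)" by simp
    qed (use s in \<open>auto intro!: integrable_continuous_real continuous_intros continuous_t r' cFr'\<close>)
    also have "\<dots> = s * K / 2 * integral {0..2 * pi} (J r) + pi / s"
      using s by (subst integral_add)
        (auto intro!: integrable_continuous_real continuous_intros continuous_t r')
    also have "integral {0..2 * pi} (J r) = h' r / r"
      using r by (simp add: h'_def)
    also have "s * K / 2 * (h' r / r) = (K / B) * (h' r * r powr (- \<alpha>) / 2)"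
      using r B by (simp add: s_def powr_diff powr_minus field_simps)
    also have "pi / s = pi * B * r powr (\<alpha> - 1)"
      using r B by (simp add: s_def powr_diff field_simps)
    also have "(K / B) * (h' r * r powr (- \<alpha>) / 2) + pi * B * r powr (\<alpha> - 1) \<le> G' r"
    proof -
      have "\<alpha> * h r * r powr (- \<alpha> - 1) \<le> (r * h' r / 2) * r powr (- \<alpha> - 1)"
        using h_growth_ineq[OF \<alpha>, of r] r by (intro mult_right_mono) auto
      also have "\<dots> = h' r * r powr (- \<alpha>) / 2" using r by (simp add: powr_diff)
      finally have "h' r * r powr (- \<alpha>) / 2 \<le> h' r * r powr (- \<alpha>) - \<alpha> * h r * r powr (- \<alpha> - 1)"
        by simp
      then have "(K / B) * (h' r * r powr (- \<alpha>) / 2) \<le> (K / B) * (h' r * r powr (- \<alpha>) - \<alpha> * h r * r powr (- \<alpha> - 1))"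
        using K B by (intro mult_left_mono) auto
      then show ?thesis by (simp add: G'_def)
    qed
    finally show ?thesis .
  qed
  have Gr: "G r \<le> (K + pi / \<alpha>) * B * r powr \<alpha>"
  proof -
    have "h r * r powr (- \<alpha>) \<le> B\<^sup>2 * r powr (2 * \<alpha>) * r powr (- \<alpha>)"
      using hB[OF r] by (intro mult_right_mono) auto
    also have "\<dots> = B\<^sup>2 * r powr \<alpha>" using r by (simp add: mult.assoc flip: powr_add)
    finally have "(K / B) * (h r * r powr (- \<alpha>)) \<le> (K / B) * (B\<^sup>2 * r powr \<alpha>)"
      using K B by (intro mult_left_mono) auto
    then show ?thesis using B by (simp add: G_def power2_eq_square algebra_simps)
  qed
  have Gpos: "0 \<le> G e" if "0 < e" "e < R" for e
    unfolding G_def using that h_nonneg[of e] K B \<alpha>0 by simp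
  \<comment> \<open>\<open>G\<close> need not be differentiable at 0, so the comparison starts at
    \<open>e > 0\<close>; continuity of \<open>m\<close> then lets \<open>e\<close> tend to
    0.\<close>
  have eps: "\<bar>m r - m e\<bar> \<le> (K + pi / \<alpha>) * B * r powr \<alpha>" if e: "0 < e" "e < r" for e
  proof -
    have "G e - m e \<le> G r - m r"
    proof (rule DERIV_nonneg_imp_nondecreasing[of e r "\<lambda>x. G x - m x"])
      fix x assume "e \<le> x" "x \<le> r"
      then have x: "0 < x" "x < R" using e r \<rho> by auto
      then show "\<exists>y. ((\<lambda>x. G x - m x) has_real_derivative y) (at x) \<and> 0 \<le> y"
        using m'G'[OF x] by (intro exI[of _ "G' x - m' x"]) (auto intro!: derivative_eq_intros dG dm)
    qed (use e in simp)
    moreover have "G e + m e \<le> G r + m r"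
    proof (rule DERIV_nonneg_imp_nondecreasing[of e r "\<lambda>x. G x + m x"])
      fix x assume "e \<le> x" "x \<le> r"
      then have x: "0 < x" "x < R" using e r \<rho> by auto
      then show "\<exists>y. ((\<lambda>x. G x + m x) has_real_derivative y) (at x) \<and> 0 \<le> y"
        using m'G'[OF x] by (intro exI[of _ "G' x + m' x"]) (auto intro!: derivative_eq_intros dG dm)
    qed (use e in simp)
    ultimately have "\<bar>m r - m e\<bar> \<le> G r - G e" by linarith
    also have "\<dots> \<le> G r" using Gpos[of e] e r \<rho> by simp
    finally show ?thesis using Gr by linarith
  qed
  have "isCont m 0" using dm[of 0] R by (auto intro: DERIV_isCont)
  then have "(m \<longlongrightarrow> m 0) (at_right 0)"
    by (simp add: isCont_def filterlim_at_split)
  then have "((\<lambda>e. \<bar>m r - m e\<bar>) \<longlongrightarrow> \<bar>m r - m 0\<bar>) (at_right 0)"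
    by (intro tendsto_intros)
  moreover have "eventually (\<lambda>e. \<bar>m r - m e\<bar> \<le> (K + pi / \<alpha>) * B * r powr \<alpha>) (at_right 0)"
    using r eps by (intro eventually_at_rightI[of 0 r]) auto
  ultimately have "\<bar>m r - m 0\<bar> \<le> (K + pi / \<alpha>) * B * r powr \<alpha>"
    by (rule tendsto_upperbound) auto
  moreover have "F 0 = (\<lambda>_. c)" using F0 by auto
  then have "m 0 = 2 * pi * c" by (simp add: m_def)
  ultimately show ?thesis by (simp add: m_def)
qed

text \<open>The Young weight \<open>s\<close> stays free, to be tuned once the energy
  \<open>r * h' r\<close> of the circle is known.\<close>

lemma angular_oscillation:
  assumes F: "\<And>t. (F has_real_derivative Ft t) (at t)"
    and cFt: "continuous_on {0..2 * pi} Ft"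
    and bd: "\<And>t. (Ft t)\<^sup>2 \<le> r\<^sup>2 * (K * J r t)"
    and r: "0 < r" "r < R" and s: "0 < s" and t: "0 \<le> t" "t \<le> 2 * pi"
  shows "\<bar>F t - F 0\<bar> \<le> s / 2 * K * (r * h' r) + pi / s"
proof -
  have r': "\<bar>r\<bar> < R" using r by simp
  define g where "g t = s / 2 * (r\<^sup>2 * (K * J r t)) + 1 / (2 * s)" for t
  have g0: "\<bar>Ft t\<bar> \<le> g t" for t
  proof -
    have "0 \<le> (s * \<bar>Ft t\<bar> - 1)\<^sup>2 / (2 * s)" using s by simp
    also have "\<dots> = s / 2 * (Ft t)\<^sup>2 + 1 / (2 * s) - \<bar>Ft t\<bar>"
      using s by (simp add: power2_eq_square field_simps)
    finally have "\<bar>Ft t\<bar> \<le> s / 2 * (Ft t)\<^sup>2 + 1 / (2 * s)" by simp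
    also have "s / 2 * (Ft t)\<^sup>2 \<le> s / 2 * (r\<^sup>2 * (K * J r t))"
      using bd[of t] s by (intro mult_left_mono) auto
    finally show ?thesis by (simp add: g_def)
  qed
  have ig: "g integrable_on {a..b}" for a b
    unfolding g_def using s by (intro integrable_continuous_real continuous_intros continuous_t r') auto
  have "(Ft has_integral F t - F 0) {0..t}"
    using t F by (intro fundamental_theorem_of_calculus)
      (auto simp: has_real_derivative_iff_has_vector_derivative[symmetric] intro: has_field_derivative_at_within)
  then have "\<bar>F t - F 0\<bar> = norm (integral {0..t} Ft)" by (simp add: integral_unique)
  also have "\<dots> \<le> integral {0..t} g"
    using t g0 ig cFt
    by (intro integral_norm_bound_integral)
       (auto intro!: integrable_continuous_real intro: continuous_on_subset)
  also have "\<dots> \<le> integral {0..2 * pi} g"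
    using t g0 ig by (intro integral_subset_le) (auto intro: order_trans[OF abs_ge_zero])
  also have "\<dots> = s / 2 * K * (r * h' r) + pi / s"
    unfolding g_def using s
    by (subst integral_add)
       (auto intro!: integrable_continuous_real continuous_intros continuous_t r' simp: h'_def power2_eq_square)
  finally show ?thesis .
qed

lemma continuous_Pr_Qr:
  "continuous_on ({- R<..<R} \<times> A) (\<lambda>(r, t). Pr r t)" "continuous_on ({- R<..<R} \<times> A) (\<lambda>(r, t). Qr r t)"
proof -
  have 1: "continuous_on ({- R<..<R} \<times> A) (\<lambda>z. M (pt (fst z) (snd z)))"
    by (rule continuous_on_compose2[OF cont_M])
       (auto intro!: continuous_intros continuous_on_compose2[OF continuous_on_dir(1)] simp: dist_norm abs_less_iff)
  have 2: "continuous_on ({- R<..<R} \<times> A) (\<lambda>z. M (pt (fst z) (snd z)) $ i $ j)" for i j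
    by (intro continuous_intros 1)
  show "continuous_on ({- R<..<R} \<times> A) (\<lambda>(r, t). Pr r t)" "continuous_on ({- R<..<R} \<times> A) (\<lambda>(r, t). Qr r t)"
    unfolding case_prod_unfold Pr_def Qr_def matrix_vector_mult_def sum_2
    by (simp_all add: continuous_intros 2)
qed

text \<open>Courant-Lebesgue selection: the mean value theorem for \<open>h\<close> on [d, 2d]
  yields a radius with energy at most 2 (h (2d) - h d), hence of order d^(2 \<alpha>). On that
  circle the oscillation is small, and \<open>radial_average\<close> ties its mean to the
  centre.\<close>

lemma good_circle:
  assumes \<alpha>: "growth_exponent K \<alpha>"
    and N: "0 < N" "\<And>x. x \<in> ball x0 R \<Longrightarrow> norm (f x) \<le> N"
    and \<rho>: "0 < \<rho>" "2 * \<rho> < R" and d: "0 < d" "2 * d \<le> \<rho>"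
  shows "\<exists>\<xi>. d < \<xi> \<and> \<xi> < 2 * d \<and> (\<forall>z i. dist x0 z = \<xi> \<longrightarrow>
    \<bar>f z $ i - f x0 $ i\<bar> \<le> 2 * (3 * K + 2 * pi + pi / \<alpha>) * sqrt (pi * K) * N * (d / \<rho>) powr \<alpha>)"
proof -
  have \<alpha>0: "0 < \<alpha>" "\<alpha> \<le> 1" using \<alpha> by (auto simp: growth_exponent_def)
  \<comment> \<open>Normalised so that the bound for \<open>h \<rho>\<close> becomes
    \<open>h r \<le> B\<^sup>2 * r powr (2 * \<alpha>)\<close>.\<close>
  define B where "B = sqrt (pi * K) * N / \<rho> powr \<alpha>"
  have B: "0 < B" using K N \<rho> by (simp add: B_def)
  have B2: "B\<^sup>2 = pi * K * N\<^sup>2 / \<rho> powr (2 * \<alpha>)"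
    using K by (simp add: B_def power_divide power_mult_distrib powr_powr power2_eq_square flip: powr_add)
  have hB: "h r \<le> B\<^sup>2 * r powr (2 * \<alpha>)" if "0 < r" "r \<le> \<rho>" for r
  proof -
    have "h r \<le> h \<rho> * (r / \<rho>) powr (2 * \<alpha>)"
      using h_growth[OF \<alpha> that] \<rho> by simp
    also have "\<dots> \<le> (pi * N\<^sup>2 * K) * (r / \<rho>) powr (2 * \<alpha>)"
      using h_bound[OF N \<rho>] by (intro mult_right_mono) auto
    also have "\<dots> = B\<^sup>2 * r powr (2 * \<alpha>)"
      using that \<rho> by (simp add: B2 powr_divide)
    finally show ?thesis .
  qed
  define D where "D = B * (2 * d) powr \<alpha>"
  have D: "0 < D" using B d by (simp add: D_def)
  obtain \<xi> where \<xi>: "d < \<xi>" "\<xi> < 2 * d" "h (2 * d) - h d = (2 * d - d) * h' \<xi>"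
    using MVT2[of d "2 * d" h h'] h_has_derivative d \<rho> by auto
  have \<xi>R: "0 < \<xi>" "\<xi> < R" "\<bar>\<xi>\<bar> < R" "\<xi> \<le> \<rho>" using \<xi> d \<rho> by auto
  have "\<xi> * h' \<xi> \<le> (2 * d) * h' \<xi>"
    using \<xi> \<xi>R h'_nonneg[of \<xi>] by (intro mult_right_mono) auto
  also have "\<dots> = 2 * (h (2 * d) - h d)" using \<xi>(3) by simp
  also have "\<dots> \<le> 2 * h (2 * d)" using h_nonneg[of d] d \<rho> by simp
  also have "\<dots> \<le> 2 * (B\<^sup>2 * (2 * d) powr (2 * \<alpha>))" using hB[of "2 * d"] d by simp
  also have "\<dots> = 2 * D\<^sup>2"
    by (simp add: D_def power_mult_distrib power2_eq_square flip: powr_add)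
  finally have hx: "\<xi> * h' \<xi> \<le> 2 * D\<^sup>2" .
  have main: "\<bar>F \<xi> t - c\<bar> \<le> (3 * K + 2 * pi + pi / \<alpha>) * D"
    if F: "\<And>r t. \<bar>r\<bar> < R \<Longrightarrow> ((\<lambda>r. F r t) has_real_derivative Fr r t) (at r)"
      and Ft: "\<And>t. (F \<xi> has_real_derivative Ft t) (at t)"
      and cF: "\<And>r. \<bar>r\<bar> < R \<Longrightarrow> continuous_on {0..2 * pi} (F r)"
      and cFr: "continuous_on ({- R<..<R} \<times> cbox 0 (2 * pi)) (\<lambda>(r, t). Fr r t)"
      and cFt: "continuous_on {0..2 * pi} Ft"
      and bd: "\<And>r t. \<bar>r\<bar> < R \<Longrightarrow> (Fr r t)\<^sup>2 \<le> K * J r t"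
      and bdt: "\<And>t. (Ft t)\<^sup>2 \<le> \<xi>\<^sup>2 * (K * J \<xi> t)"
      and F0: "\<And>t. F 0 t = c" and t: "0 \<le> t" "t \<le> 2 * pi"
    for F Fr Ft c t
  proof -
    have osc: "\<bar>F \<xi> t - F \<xi> 0\<bar> \<le> (K + pi) * D" if "0 \<le> t" "t \<le> 2 * pi" for t
    proof -
      \<comment> \<open>The weight \<open>1 / D\<close> balances both terms, the energy being at
        most \<open>2 * D\<^sup>2\<close>.\<close>
      have "\<bar>F \<xi> t - F \<xi> 0\<bar> \<le> (1 / D) / 2 * K * (\<xi> * h' \<xi>) + pi / (1 / D)"
        using angular_oscillation[OF Ft cFt bdt \<xi>R(1,2) _ that, of "1 / D"] D by simp
      also have "(1 / D) / 2 * K * (\<xi> * h' \<xi>) \<le> (1 / D) / 2 * K * (2 * D\<^sup>2)"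
        using hx D K by (intro mult_left_mono) auto
      also have "(1 / D) / 2 * K * (2 * D\<^sup>2) = K * D" using D by (simp add: power2_eq_square)
      finally show ?thesis using D by (simp add: algebra_simps)
    qed
    have avg: "\<bar>integral {0..2 * pi} (F \<xi>) - 2 * pi * c\<bar> \<le> (K + pi / \<alpha>) * D"
    proof -
      have "\<bar>integral {0..2 * pi} (F \<xi>) - 2 * pi * c\<bar> \<le> (K + pi / \<alpha>) * B * \<xi> powr \<alpha>"
        using \<rho> by (intro radial_average[OF \<alpha> B _ hB F cF cFr bd F0 \<xi>R(1,4)]) auto
      also have "\<dots> \<le> (K + pi / \<alpha>) * B * (2 * d) powr \<alpha>"
        using \<xi> \<xi>R \<alpha>0 K B by (intro mult_left_mono powr_mono2) auto
      finally show ?thesis by (simp add: D_def mult.assoc)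
    qed
    have iF: "F \<xi> integrable_on {0..2 * pi}"
      by (intro integrable_continuous_real cF \<xi>R)
    have "((\<lambda>t. F \<xi> t - F \<xi> 0) has_integral (integral {0..2 * pi} (F \<xi>) - (2 * pi - 0) * F \<xi> 0)) {0..2 * pi}"
      using has_integral_const_real[of "F \<xi> 0" 0 "2 * pi"]
      by (intro has_integral_diff integrable_integral iF) auto
    from has_integral_bound_real[OF _ finite.emptyI this, of "(K + pi) * D"] have "\<bar>integral {0..2 * pi} (F \<xi>) - 2 * pi * F \<xi> 0\<bar> \<le> 2 * pi * ((K + pi) * D)"
      using osc K D by (simp add: mult.commute)
    with avg have "\<bar>2 * pi * (F \<xi> 0 - c)\<bar> \<le> 2 * pi * ((K + pi) * D) + (K + pi / \<alpha>) * D"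
      by (simp add: algebra_simps)
    also have "(K + pi / \<alpha>) * D \<le> 2 * pi * ((K + pi / \<alpha>) * D)"
      using pi_gt3 K \<alpha>0 D by (intro mult_right_mono[of 1 "2 * pi", simplified mult_1_left]) auto
    also have "\<bar>2 * pi * (F \<xi> 0 - c)\<bar> = 2 * pi * \<bar>F \<xi> 0 - c\<bar>" by (simp add: abs_mult)
    finally have "2 * pi * \<bar>F \<xi> 0 - c\<bar> \<le> 2 * pi * ((K + pi) * D + (K + pi / \<alpha>) * D)"
      by (simp only: distrib_left)
    then have "\<bar>F \<xi> 0 - c\<bar> \<le> (K + pi) * D + (K + pi / \<alpha>) * D"
      by (subst (asm) mult_le_cancel_left_pos) auto
    with osc[OF t] show ?thesis by (simp add: algebra_simps)
  qed
  have DN: "D \<le> 2 * (sqrt (pi * K) * N * (d / \<rho>) powr \<alpha>)"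
  proof -
    have "2 powr \<alpha> \<le> (2::real) powr 1" using \<alpha>0 by (intro powr_mono) auto
    then have "2 powr \<alpha> * (B * d powr \<alpha>) \<le> 2 * (B * d powr \<alpha>)"
      using B by (intro mult_right_mono) auto
    then show ?thesis using d \<rho> by (simp add: D_def B_def powr_mult powr_divide mult_ac)
  qed
  have bnd: "(3 * K + 2 * pi + pi / \<alpha>) * D \<le> 2 * (3 * K + 2 * pi + pi / \<alpha>) * sqrt (pi * K) * N * (d / \<rho>) powr \<alpha>"
  proof -
    have "0 \<le> 3 * K + 2 * pi + pi / \<alpha>" using K \<alpha>0 by simp
    from mult_left_mono[OF DN this] show ?thesis by (simp only: mult_ac)
  qed
  have "\<bar>f z $ i - f x0 $ i\<bar> \<le> 2 * (3 * K + 2 * pi + pi / \<alpha>) * sqrt (pi * K) * N * (d / \<rho>) powr \<alpha>"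
    if z: "dist x0 z = \<xi>" for z and i :: 2
  proof -
    obtain t where t: "0 \<le> t" "t \<le> 2 * pi" "z - x0 = norm (z - x0) *\<^sub>R dir t"
      using exists_dir[of "z - x0"] by blast
    then have zt: "z = pt \<xi> t" using z by (metis add_diff_cancel_left' diff_add_cancel add.commute dist_commute dist_norm)
    have Psq: "(Pr r t)\<^sup>2 \<le> K * J r t" "(Qr r t)\<^sup>2 \<le> K * J r t" if "\<bar>r\<bar> < R" for r t
      using frame(3)[OF that, of t] by (smt (verit) zero_le_power2)+
    have Psq': "(Pt \<xi> t)\<^sup>2 \<le> \<xi>\<^sup>2 * (K * J \<xi> t)" "(Qt \<xi> t)\<^sup>2 \<le> \<xi>\<^sup>2 * (K * J \<xi> t)" for t
      using frame(2)[OF \<xi>R(3), of t] by (smt (verit) zero_le_power2)+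
    have "\<bar>P \<xi> t - f x0 $ 1\<bar> \<le> (3 * K + 2 * pi + pi / \<alpha>) * D"
      by (intro main[where F = P and Ft = "Pt \<xi>" and Fr = Pr]
          has_derivative_r has_derivative_t continuous_t continuous_Pr_Qr Psq Psq' t \<xi>R; simp add: P_def)
    moreover have "\<bar>Q \<xi> t - f x0 $ 2\<bar> \<le> (3 * K + 2 * pi + pi / \<alpha>) * D"
      by (intro main[where F = Q and Ft = "Qt \<xi>" and Fr = Qr]
          has_derivative_r has_derivative_t continuous_t continuous_Pr_Qr Psq Psq' t \<xi>R; simp add: Q_def)
    ultimately show ?thesis
      using bnd exhaust_2[of i] by (auto simp: zt P_def Q_def)
  qed
  with \<xi> show ?thesis by blast
qed

end

section \<open>Hoelder and gradient estimates\<close>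

text \<open>The distance from \<open>y\<close> to a point moving on the circle about
  \<open>x\<close> runs continuously from \<open>a - d\<close> to \<open>a + d\<close>, and
  \<open>b\<close> lies between.\<close>

lemma circles_intersect:
  fixes x y :: "real^2"
  assumes d: "dist x y = d" and a: "d < a" "a < 2 * d" and b: "d < b" "b < 2 * d"
  shows "\<exists>z. dist x z = a \<and> dist y z = b"
proof -
  obtain t where t: "y - x = norm (y - x) *\<^sub>R dir t" using exists_dir by blast
  then have y: "y = x + d *\<^sub>R dir t" using d by (metis add_diff_cancel_left' diff_add_cancel add.commute dist_commute dist_norm)
  define g where "g s = dist y (x + a *\<^sub>R dir s)" for s
  have g1: "g t = a - d"
  proof -
    have "g t = norm ((d - a) *\<^sub>R dir t)"
      unfolding g_def y dist_norm by (simp add: algebra_simps)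
    then show ?thesis using a by simp
  qed
  have g2: "g (t + pi) = a + d"
  proof -
    have "dir (t + pi) = - dir t" by (simp add: dir_def)
    then have "g (t + pi) = norm ((d + a) *\<^sub>R dir t)"
      unfolding g_def y dist_norm by (simp add: algebra_simps)
    then show ?thesis using a b by simp
  qed
  have "continuous_on {t..t + pi} g"
    unfolding g_def by (intro continuous_intros continuous_on_dir)
  then obtain s where "g s = b"
    using IVT'[of g t b "t + pi"] g1 g2 a b by auto
  moreover have "dist x (x + a *\<^sub>R dir s) = a" using a b by (simp add: dist_norm)
  ultimately show ?thesis unfolding g_def by blast
qed

lemma norm_vec2_le: "norm (v :: real^2) \<le> \<bar>v $ 1\<bar> + \<bar>v $ 2\<bar>"
  using norm_le_l1_cart[of v] by (simp add: sum_2)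

text \<open>64 = 2 * 4 * 8: the 2 of \<open>good_circle\<close>, two circles and two components, and
  \<open>8 powr \<alpha> \<le> 8\<close> from the choice \<rho> = R/8.\<close>

definition holder_const :: "real \<Rightarrow> real \<Rightarrow> real"
  where "holder_const K \<alpha> = 64 * (3 * K + 2 * pi + pi / \<alpha>) * sqrt (pi * K)"

lemma holder_const_pos: "1 \<le> K \<Longrightarrow> 0 < \<alpha> \<Longrightarrow> 0 < holder_const K \<alpha>"
  by (auto simp: holder_const_def intro!: mult_pos_pos add_pos_pos)

text \<open>The good circles about \<open>x\<close> and \<open>y\<close> meet, and a common point
  links the two centre values. Balls of radius R/2 about both points stay inside the given one, and
  R/8 is a radius \<rho> admissible for both.\<close>

lemma elliptic_field_holder:
  assumes E: "elliptic_field f M (ball x R) K" and \<alpha>: "growth_exponent K \<alpha>"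
    and N: "\<And>z. z \<in> ball x R \<Longrightarrow> norm (f z) \<le> N"
    and R: "0 < R" and xy: "dist x y \<le> R / 16"
  shows "norm (f x - f y) \<le> holder_const K \<alpha> * N * (dist x y / R) powr \<alpha>"
proof -
  interpret elliptic_field f M "ball x R" K by fact
  have N0: "0 \<le> N" using N[of x] R norm_ge_zero order_trans by (metis centre_in_ball)
  define d where "d = dist x y"
  consider "d = 0" | "N = 0" | "0 < d" "0 < N" using N0 by (force simp: d_def)
  then show ?thesis
  proof cases
    case 1
    then show ?thesis by (simp add: d_def)
  next
    case 2
    then show ?thesis using N[of x] N[of y] R xy by (simp add: dist_norm)
  next
    case 3
    have \<alpha>0: "0 < \<alpha>" "\<alpha> \<le> 1" using \<alpha> by (auto simp: growth_exponent_def)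
    define A where "A = 2 * (3 * K + 2 * pi + pi / \<alpha>) * sqrt (pi * K) * N * (d / (R / 8)) powr \<alpha>"
    have sub: "ball y (R / 2) \<subseteq> ball x R" "ball x (R / 2) \<subseteq> ball x R"
      using xy R by (auto simp: subset_iff) (smt (verit) dist_triangle field_sum_of_halves)
    interpret X: polar_field f M x "R / 2" K
      using subset[OF sub(2)] R by (simp add: polar_field_def polar_field_axioms_def)
    interpret Y: polar_field f M y "R / 2" K
      using subset[OF sub(1)] R by (simp add: polar_field_def polar_field_axioms_def)
    have "\<exists>\<xi>. d < \<xi> \<and> \<xi> < 2 * d \<and> (\<forall>z i. dist x z = \<xi> \<longrightarrow> \<bar>f z $ i - f x $ i\<bar> \<le> A)"
      unfolding A_def using 3 xy R N sub by (intro X.good_circle[OF \<alpha>]) (auto simp: d_def)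
    then obtain a where a: "d < a" "a < 2 * d" "\<And>z i. dist x z = a \<Longrightarrow> \<bar>f z $ i - f x $ i\<bar> \<le> A" by blast
    have "\<exists>\<xi>. d < \<xi> \<and> \<xi> < 2 * d \<and> (\<forall>z i. dist y z = \<xi> \<longrightarrow> \<bar>f z $ i - f y $ i\<bar> \<le> A)"
      unfolding A_def using 3 xy R N sub by (intro Y.good_circle[OF \<alpha>]) (auto simp: d_def)
    then obtain b where b: "d < b" "b < 2 * d" "\<And>z i. dist y z = b \<Longrightarrow> \<bar>f z $ i - f y $ i\<bar> \<le> A" by blast
    obtain z where z: "dist x z = a" "dist y z = b"
      using circles_intersect[OF d_def[symmetric] a(1,2) b(1,2)] by blast
    have "\<bar>(f x - f y) $ i\<bar> \<le> 2 * A" for i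
      using a(3)[OF z(1), of i] b(3)[OF z(2), of i] by simp
    from this[of 1] this[of 2] have "norm (f x - f y) \<le> 4 * A"
      using norm_vec2_le[of "f x - f y"] by simp
    also have "4 * A = (8 * (3 * K + 2 * pi + pi / \<alpha>) * sqrt (pi * K) * N * (d / R) powr \<alpha>) * 8 powr \<alpha>"
    proof -
      have "d / (R / 8) = d / R * 8" by simp
      also have "\<dots> powr \<alpha> = (d / R) powr \<alpha> * 8 powr \<alpha>"
        by (rule powr_mult)
      finally show ?thesis by (simp add: A_def)
    qed
    also have "\<dots> \<le> (8 * (3 * K + 2 * pi + pi / \<alpha>) * sqrt (pi * K) * N * (d / R) powr \<alpha>) * 8"
    proof (rule mult_left_mono)
      show "8 powr \<alpha> \<le> (8::real)" using powr_mono[of \<alpha> 1 8] \<alpha>0 by simp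
    qed (use K \<alpha>0 N0 in simp)
    also have "\<dots> = holder_const K \<alpha> * N * (dist x y / R) powr \<alpha>"
      by (simp add: holder_const_def d_def)
    finally show ?thesis .
  qed
qed

text \<open>The minimum is the fraction \<epsilon> of a radius on which the gradient is nearly
  constant, with \<open>holder_const K \<alpha> * \<epsilon> powr \<alpha> \<le> 1 / 4\<close>. The
  16 collects the numerical losses of \<open>interior_gradient_bound\<close>.\<close>

definition gradient_const :: "real \<Rightarrow> real \<Rightarrow> real"
  where "gradient_const K \<alpha> = 16 / min (1 / 16) ((1 / (4 * holder_const K \<alpha>)) powr (1 / \<alpha>))"

lemma gradient_const_pos: "1 \<le> K \<Longrightarrow> 0 < \<alpha> \<Longrightarrow> 0 < gradient_const K \<alpha>"
  using holder_const_pos[of K \<alpha>] by (auto simp: gradient_const_def min_def)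

text \<open>Maximizing \<open>(\<rho> - \<bar>y - x\<bar>) \<bar>\<nabla>v(y)\<bar>\<close> gives a ball on which the gradient is at most twice its
  value at the centre; by the Hoelder estimate it is then nearly constant on a fixed fraction of
  that ball, where \<open>v\<close> would oscillate too much if the gradient were large.\<close>

lemma interior_gradient_bound:
  assumes E: "elliptic_field f M (ball x R) K" and \<alpha>: "growth_exponent K \<alpha>"
    and v: "\<And>z. z \<in> ball x R \<Longrightarrow> (v has_derivative (\<lambda>h. f z \<bullet> h)) (at z)"
    and A: "\<And>z. z \<in> ball x R \<Longrightarrow> \<bar>v z\<bar> \<le> A" and R: "0 < R"
  shows "norm (f x) \<le> gradient_const K \<alpha> * A / R"
proof -
  interpret elliptic_field f M "ball x R" K by fact
  have \<alpha>0: "0 < \<alpha>" "\<alpha> \<le> 1" using \<alpha> by (auto simp: growth_exponent_def)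
  define c where "c = holder_const K \<alpha>"
  have c: "0 < c" unfolding c_def using K \<alpha>0 by (intro holder_const_pos)
  define \<epsilon> where "\<epsilon> = min (1 / 16) ((1 / (4 * c)) powr (1 / \<alpha>))"
  have \<epsilon>: "0 < \<epsilon>" "\<epsilon> \<le> 1 / 16" using c by (auto simp: \<epsilon>_def)
  have \<epsilon>c: "c * \<epsilon> powr \<alpha> \<le> 1 / 4"
  proof -
    have "\<epsilon> powr \<alpha> \<le> ((1 / (4 * c)) powr (1 / \<alpha>)) powr \<alpha>"
      using \<epsilon> \<alpha>0 by (intro powr_mono2) (auto simp: \<epsilon>_def)
    also have "\<dots> = 1 / (4 * c)" using \<alpha>0 c by (simp add: powr_powr)
    finally show ?thesis using c by (simp add: field_simps)
  qed
  have gc: "gradient_const K \<alpha> = 16 / \<epsilon>" by (simp add: gradient_const_def \<epsilon>_def c_def)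
  define \<rho> where "\<rho> = R / 2"
  have \<rho>: "0 < \<rho>" "\<rho> < R" using R by (auto simp: \<rho>_def)
  define g where "g y = (\<rho> - dist x y) * norm (f y)" for y
  have sub: "cball x \<rho> \<subseteq> ball x R" using \<rho> by auto
  have "continuous_on (cball x \<rho>) g"
    unfolding g_def by (intro continuous_intros continuous_on_subset[OF cont_f sub])
  then obtain y where y: "y \<in> cball x \<rho>" "\<And>z. z \<in> cball x \<rho> \<Longrightarrow> g z \<le> g y"
    using continuous_attains_sup[of "cball x \<rho>" g] \<rho> by force
  have gx: "\<rho> * norm (f x) \<le> g y" using y(2)[of x] \<rho> by (simp add: g_def)
  have A0: "0 \<le> A" using A[of x] R by simp
  show ?thesis
  proof (cases "g y \<le> 0")
    case True
    then have "norm (f x) \<le> 0" using gx \<rho> by (meson linorder_not_le mult_pos_pos order_less_le_trans)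
    then show ?thesis using A0 R \<epsilon> unfolding gc by simp
  next
    case False
    define n where "n = norm (f y)"
    have yr: "dist x y < \<rho>" and n: "0 < n"
      using False y(1) by (auto simp: g_def n_def zero_less_mult_iff not_le)
    \<comment> \<open>On \<open>ball y r\<close> the weight is still at least \<open>r\<close>, half
      its value at \<open>y\<close>; by maximality the gradient at most doubles there.\<close>
    define r where "r = (\<rho> - dist x y) / 2"
    have r: "0 < r" using yr by (simp add: r_def)
    have gy: "g y = 2 * r * n" by (simp add: g_def r_def n_def)
    have sr: "ball y r \<subseteq> cball x \<rho>"
    proof
      fix z assume "z \<in> ball y r"
      then have "dist x z \<le> dist x y + r" using dist_triangle[of x z y] by simp
      moreover have "dist x y + r \<le> \<rho>" using yr by (simp add: r_def field_simps)
      ultimately show "z \<in> cball x \<rho>" by simp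
    qed
    have le: "norm (f z) \<le> 2 * n" if z: "z \<in> ball y r" for z
    proof -
      have "dist x z \<le> dist x y + r" using dist_triangle[of x z y] z by simp
      then have "r \<le> \<rho> - dist x z" by (simp add: r_def field_simps)
      then have "r * norm (f z) \<le> g z" unfolding g_def by (intro mult_right_mono) auto
      also have "\<dots> \<le> r * (2 * n)" using y(2)[of z] z sr gy by auto
      finally show ?thesis using r by simp
    qed
    have Ey: "elliptic_field f M (ball y r) K"
      using subset sr sub by blast
    have near: "norm (f y - f z) \<le> n / 2" if z: "dist y z \<le> \<epsilon> * r" for z
    proof -
      have "\<epsilon> * r \<le> 1 / 16 * r" using \<epsilon>(2) r by (intro mult_right_mono) auto
      with z have z16: "dist y z \<le> r / 16" by linarith
      have "norm (f y - f z) \<le> holder_const K \<alpha> * (2 * n) * (dist y z / r) powr \<alpha>"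
        by (rule elliptic_field_holder[OF Ey \<alpha> le r z16])
      also have "\<dots> \<le> c * (2 * n) * \<epsilon> powr \<alpha>"
        unfolding c_def[symmetric] using z r c n \<alpha>0
        by (intro mult_left_mono powr_mono2) (auto simp: field_simps)
      also have "\<dots> \<le> n / 2" using mult_left_mono[OF \<epsilon>c, of "2 * n"] n by (simp add: mult_ac)
      finally show ?thesis .
    qed
    \<comment> \<open>Along the gradient direction at \<open>y\<close> the slope of \<open>v\<close>
      stays at least \<open>n / 2\<close> up to length \<open>T\<close>, while \<open>v\<close> can
      change by at most \<open>2 * A\<close>.\<close>
    define e where "e = (1 / n) *\<^sub>R f y"
    have e: "norm e = 1" "f y \<bullet> e = n"
      using n by (auto simp: e_def n_def power2_norm_eq_inner[symmetric] power2_eq_square)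
    define T where "T = \<epsilon> * r"
    have T: "0 < T" "T < r" using \<epsilon> r by (auto simp: T_def)
    have seg: "dist y (y + s *\<^sub>R e) = s" if "0 \<le> s" for s using that e by (simp add: dist_norm)
    have inR: "y + s *\<^sub>R e \<in> ball x R" if "0 \<le> s" "s \<le> T" for s
      using sub sr seg[OF that(1)] that T by (metis mem_ball order_le_less_trans subsetD)
    have "((\<lambda>s. v (y + s *\<^sub>R e)) has_real_derivative f (y + s *\<^sub>R e) \<bullet> e) (at s)" if "0 \<le> s" "s \<le> T" for s
    proof -
      have "((\<lambda>s. y + s *\<^sub>R e) has_derivative (\<lambda>h. h *\<^sub>R e)) (at s)"
        by (auto intro!: derivative_eq_intros)
      then have "((\<lambda>s. v (y + s *\<^sub>R e)) has_derivative (\<lambda>h. f (y + s *\<^sub>R e) \<bullet> (h *\<^sub>R e))) (at s)"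
        using v[OF inR[OF that]] by (rule has_derivative_compose)
      then show ?thesis by (rule has_derivative_imp_has_field_derivative) simp
    qed
    from MVT2[OF T(1) this] obtain s where s: "0 < s" "s < T"
      and eq: "v (y + T *\<^sub>R e) - v (y + 0 *\<^sub>R e) = (T - 0) * (f (y + s *\<^sub>R e) \<bullet> e)"
      by blast
    have "\<bar>(f y - f (y + s *\<^sub>R e)) \<bullet> e\<bar> \<le> norm (f y - f (y + s *\<^sub>R e)) * norm e"
      by (rule Cauchy_Schwarz_ineq2)
    also have "\<dots> \<le> n / 2" using near[of "y + s *\<^sub>R e"] seg[of s] s e by (simp add: T_def)
    finally have "\<bar>n - f (y + s *\<^sub>R e) \<bullet> e\<bar> \<le> n / 2" by (simp only: inner_diff_left e(2))
    then have "n / 2 \<le> f (y + s *\<^sub>R e) \<bullet> e" by linarith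
    then have "T * (n / 2) \<le> T * (f (y + s *\<^sub>R e) \<bullet> e)" using T by (intro mult_left_mono) auto
    also have "\<dots> \<le> 2 * A"
      using eq A[OF inR[of T]] A[OF inR[of 0]] T by simp
    finally have "\<epsilon> * (2 * r * n) \<le> 8 * A" by (simp add: T_def mult_ac)
    moreover have "\<epsilon> * (\<rho> * norm (f x)) \<le> \<epsilon> * (2 * r * n)"
      using gx gy \<epsilon> by (intro mult_left_mono) auto
    ultimately have "\<epsilon> * (\<rho> * norm (f x)) \<le> 8 * A" by linarith
    then show ?thesis unfolding gc using \<epsilon> R by (simp add: \<rho>_def field_simps)
  qed
qed

section \<open>Hessians of solutions\<close>

lemma gradient_works:
  assumes "u differentiable (at x)"
  shows "(u has_derivative (\<lambda>h. gradient u x \<bullet> h)) (at x)"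
proof -
  define L where "L = frechet_derivative u (at x)"
  have L: "(u has_derivative L) (at x)"
    using assms unfolding L_def by (simp add: frechet_derivative_works)
  then have lin: "linear L" by (rule has_derivative_linear)
  have Lh: "L h = gradient u x \<bullet> h" for h
  proof -
    have "h = (\<Sum>i\<in>UNIV. (h $ i) *\<^sub>R axis i 1)"
      using basis_expansion[of h] by (simp add: scalar_mult_eq_scaleR)
    from arg_cong[OF this, of L]
    have "L h = (\<Sum>i\<in>UNIV. (h $ i) *\<^sub>R L (axis i 1))"
      unfolding linear_sum[OF lin] by (simp only: linear_scale[OF lin])
    then show ?thesis
      by (simp add: gradient_def inner_vec_def L_def mult.commute)
  qed
  have "L = (\<lambda>h. gradient u x \<bullet> h)" using Lh by (rule ext)
  then show ?thesis using L by simp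
qed

lemma hessian_works:
  assumes "C2_on S u" "x \<in> S"
  shows "(gradient u has_derivative (\<lambda>h. hessian u x *v h)) (at x)"
  using assms unfolding C2_on_def hessian_def by (simp add: jacobian_works[symmetric])

text \<open>The mean value theorem along \<open>a\<close> and then along \<open>b\<close>.
  Exchanging \<open>a\<close> and \<open>b\<close> leaves the second difference unchanged, which is
  the route to symmetry of the Hessian.\<close>

lemma second_difference:
  fixes u :: "'a::euclidean_space \<Rightarrow> real" and f :: "'a \<Rightarrow> 'a"
  assumes u: "\<And>z. z \<in> ball x r \<Longrightarrow> (u has_derivative (\<lambda>h. f z \<bullet> h)) (at z)"
    and f: "\<And>z. z \<in> ball x r \<Longrightarrow> (f has_derivative M z) (at z)"
    and s: "0 < s" "s * (norm a + norm b) < r"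
  shows "\<exists>p. dist x p \<le> s * (norm a + norm b) \<and>
    u (x + s *\<^sub>R a + s *\<^sub>R b) - u (x + s *\<^sub>R a) - u (x + s *\<^sub>R b) + u x = s\<^sup>2 * (M p b \<bullet> a)"
proof -
  have near: "dist x (x + t *\<^sub>R a + q *\<^sub>R b) \<le> s * (norm a + norm b)" if "0 \<le> t" "t \<le> s" "0 \<le> q" "q \<le> s" for t q
  proof -
    have "dist x (x + t *\<^sub>R a + q *\<^sub>R b) = norm (t *\<^sub>R a + q *\<^sub>R b)"
      unfolding dist_norm norm_minus_commute[of x] by (simp add: algebra_simps)
    also have "\<dots> \<le> t * norm a + q * norm b"
      using norm_triangle_ineq[of "t *\<^sub>R a" "q *\<^sub>R b"] that by simp
    also have "\<dots> \<le> s * norm a + s * norm b" using that by (intro add_mono mult_right_mono) auto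
    finally show ?thesis by (simp add: distrib_left)
  qed
  have inb: "x + t *\<^sub>R a + q *\<^sub>R b \<in> ball x r" if "0 \<le> t" "t \<le> s" "0 \<le> q" "q \<le> s" for t q
    using le_less_trans[OF near[OF that] s(2)] unfolding mem_ball .
  define \<phi> where "\<phi> t = u (x + t *\<^sub>R a + s *\<^sub>R b) - u (x + t *\<^sub>R a + 0 *\<^sub>R b)" for t
  have d1: "((\<lambda>t. u (x + t *\<^sub>R a + q *\<^sub>R b)) has_real_derivative f (x + t *\<^sub>R a + q *\<^sub>R b) \<bullet> a) (at t)"
    if "0 \<le> t" "t \<le> s" "0 \<le> q" "q \<le> s" for t q
  proof -
    have "((\<lambda>t. x + t *\<^sub>R a + q *\<^sub>R b) has_derivative (\<lambda>h. h *\<^sub>R a)) (at t)"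
      by (auto intro!: derivative_eq_intros)
    from has_derivative_compose[OF this u[OF inb[OF that]]]
    show ?thesis by (rule has_derivative_imp_has_field_derivative) simp
  qed
  have "\<And>t. 0 \<le> t \<Longrightarrow> t \<le> s \<Longrightarrow>
      (\<phi> has_real_derivative f (x + t *\<^sub>R a + s *\<^sub>R b) \<bullet> a - f (x + t *\<^sub>R a + 0 *\<^sub>R b) \<bullet> a) (at t)"
    unfolding \<phi>_def using s by (intro DERIV_diff d1) auto
  from MVT2[OF s(1) this] obtain t where t: "0 < t" "t < s"
    "\<phi> s - \<phi> 0 = (s - 0) * (f (x + t *\<^sub>R a + s *\<^sub>R b) \<bullet> a - f (x + t *\<^sub>R a + 0 *\<^sub>R b) \<bullet> a)" by blast
  have "((\<lambda>q. f (x + t *\<^sub>R a + q *\<^sub>R b) \<bullet> a) has_real_derivative M (x + t *\<^sub>R a + q *\<^sub>R b) b \<bullet> a) (at q)"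
    if q: "0 \<le> q" "q \<le> s" for q
  proof -
    have z: "x + t *\<^sub>R a + q *\<^sub>R b \<in> ball x r" using inb[of t q] t q by simp
    have "((\<lambda>q. x + t *\<^sub>R a + q *\<^sub>R b) has_derivative (\<lambda>h. h *\<^sub>R b)) (at q)"
      by (auto intro!: derivative_eq_intros)
    from has_derivative_inner_left[OF has_derivative_compose[OF this f[OF z]], of a]
    show ?thesis
      by (rule has_derivative_imp_has_field_derivative)
         (simp add: linear_scale[OF has_derivative_linear[OF f[OF z]]])
  qed
  from MVT2[OF s(1) this] obtain q where q: "0 < q" "q < s"
    "f (x + t *\<^sub>R a + s *\<^sub>R b) \<bullet> a - f (x + t *\<^sub>R a + 0 *\<^sub>R b) \<bullet> a = (s - 0) * (M (x + t *\<^sub>R a + q *\<^sub>R b) b \<bullet> a)" by blast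
  show ?thesis
  proof (intro exI conjI)
    show "dist x (x + t *\<^sub>R a + q *\<^sub>R b) \<le> s * (norm a + norm b)" using t q by (intro near) auto
    show "u (x + s *\<^sub>R a + s *\<^sub>R b) - u (x + s *\<^sub>R a) - u (x + s *\<^sub>R b) + u x = s\<^sup>2 * (M (x + t *\<^sub>R a + q *\<^sub>R b) b \<bullet> a)"
      using t(3) unfolding q(3) by (simp add: \<phi>_def power2_eq_square)
  qed
qed

text \<open>\<open>F\<close> is constrained on \<open>Sym2\<close> only, so ellipticity becomes
  available through this. One second difference equals the two mixed entries at two points near
  \<open>x\<close>, and continuity of the Hessian carries the equality to \<open>x\<close>.\<close>

lemma hessian_symmetric:
  assumes C2: "C2_on S u" and S: "open S" and x: "x \<in> S"
  shows "hessian u x $ 1 $ 2 = hessian u x $ 2 $ 1"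
proof (rule ccontr)
  assume ne: "hessian u x $ 1 $ 2 \<noteq> hessian u x $ 2 $ 1"
  define e where "e = \<bar>hessian u x $ 1 $ 2 - hessian u x $ 2 $ 1\<bar> / 2"
  have e: "0 < e" using ne by (simp add: e_def)
  have "isCont (hessian u) x"
    using C2 S x by (auto simp: C2_on_def continuous_on_eq_continuous_at)
  then obtain d where d: "0 < d" "\<And>p. dist x p < d \<Longrightarrow> norm (hessian u p - hessian u x) < e"
    using e unfolding continuous_at_eps_delta by (metis dist_commute dist_norm)
  obtain r where r: "0 < r" "ball x r \<subseteq> S" using S x by (auto simp: open_contains_ball)
  define s where "s = min d r / 4"
  have s: "0 < s" "s * 2 < r" "s * 2 < d" using d(1) r(1) by (auto simp: s_def min_def)
  define a b :: "real^2" where "a = axis 1 1" and "b = axis 2 1"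
  have ab: "norm a = 1" "norm b = 1" by (auto simp: a_def b_def)
  have D1: "\<And>z. z \<in> ball x r \<Longrightarrow> (u has_derivative (\<lambda>h. gradient u z \<bullet> h)) (at z)"
    using C2 r by (intro gradient_works) (auto simp: C2_on_def)
  have D2: "\<And>z. z \<in> ball x r \<Longrightarrow> (gradient u has_derivative (\<lambda>h. hessian u z *v h)) (at z)"
    using hessian_works[OF C2] r by blast
  obtain p where p: "dist x p \<le> s * 2"
    "u (x + s *\<^sub>R a + s *\<^sub>R b) - u (x + s *\<^sub>R a) - u (x + s *\<^sub>R b) + u x = s\<^sup>2 * ((hessian u p *v b) \<bullet> a)"
    using second_difference[OF D1 D2 s(1), where a = a and b = b] s ab by auto
  obtain q where q: "dist x q \<le> s * 2"
    "u (x + s *\<^sub>R b + s *\<^sub>R a) - u (x + s *\<^sub>R b) - u (x + s *\<^sub>R a) + u x = s\<^sup>2 * ((hessian u q *v a) \<bullet> b)"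
    using second_difference[OF D1 D2 s(1), where a = b and b = a] s ab by auto
  have "s\<^sup>2 * ((hessian u p *v b) \<bullet> a) = s\<^sup>2 * ((hessian u q *v a) \<bullet> b)"
    unfolding p(2)[symmetric] q(2)[symmetric] by (simp add: add_ac)
  then have "(hessian u p *v b) \<bullet> a = (hessian u q *v a) \<bullet> b" using s by simp
  then have eq: "hessian u p $ 1 $ 2 = hessian u q $ 2 $ 1"
    by (simp add: a_def b_def inner_axis matrix_vector_mult_basis column_def)
  have cl: "\<bar>hessian u p $ i $ j - hessian u x $ i $ j\<bar> < e" if "dist x p \<le> s * 2" for p i j
  proof -
    have "\<bar>(hessian u p - hessian u x) $ i $ j\<bar> \<le> norm ((hessian u p - hessian u x) $ i)"
      by (rule component_le_norm_cart)
    also have "\<dots> \<le> norm (hessian u p - hessian u x)" by (rule Finite_Cartesian_Product.norm_nth_le)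
    also have "\<dots> < e" using d(2)[of p] that s by simp
    finally show ?thesis by simp
  qed
  have "\<bar>hessian u x $ 1 $ 2 - hessian u x $ 2 $ 1\<bar> < 2 * e"
    using cl[OF p(1), of 1 2] cl[OF q(1), of 2 1] eq by linarith
  then show False by (simp add: e_def)
qed

lemma pos_semidef_2:
  assumes sym: "A $ 1 $ 2 = A $ 2 $ 1" and tr: "0 \<le> trace A" and det: "0 \<le> det A"
  shows "pos_semidef A"
  unfolding pos_semidef_def
proof
  fix v :: "real^2"
  define x y z where "x = A $ 1 $ 1" "y = A $ 2 $ 1" "z = A $ 2 $ 2"
  have T: "0 \<le> x + z" using tr by (simp add: x_y_z_def trace_def sum_2)
  have D: "y * y \<le> x * z" using det sym by (simp add: x_y_z_def det_2)
  have form: "v \<bullet> (A *v v) = x * (v $ 1)\<^sup>2 + 2 * y * (v $ 1) * (v $ 2) + z * (v $ 2)\<^sup>2"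
    using sym by (simp add: x_y_z_def inner_vec_def matrix_vector_mult_def sum_2 power2_eq_square algebra_simps)
  have xz: "0 \<le> x * z" using D by (meson order_trans zero_le_square)
  have x: "0 \<le> x" and z: "0 \<le> z" using xz T by (auto simp: zero_le_mult_iff)
  show "0 \<le> v \<bullet> (A *v v)"
  proof (cases "x = 0")
    case True
    then have "y * y \<le> 0" using D by simp
    then have "y = 0" using zero_le_square[of y] by simp
    then show ?thesis using True z by (simp add: form)
  next
    case False
    have "0 \<le> (x * v $ 1 + y * v $ 2)\<^sup>2 + (x * z - y * y) * (v $ 2)\<^sup>2" using D by simp
    also have "\<dots> = x * (v \<bullet> (A *v v))" by (simp add: form power2_eq_square algebra_simps)
    finally show ?thesis using False x by (simp add: zero_le_mult_iff)
  qed
qed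

lemma Sym2_iff: "A \<in> Sym2 \<longleftrightarrow> A $ 1 $ 2 = A $ 2 $ 1"
  by (auto simp: Sym2_def transpose_def vec_eq_iff forall_2)

text \<open>If \<open>F A = F B\<close>, split \<open>A - B = N\<^sub>1 - N\<^sub>2\<close> into positive and negative part and compare both
  \<open>A\<close> and \<open>B\<close> with \<open>B - N\<^sub>2\<close>.\<close>

lemma elliptic_cone_diff:
  assumes F: "uniformly_elliptic lam Lam F" and A: "A \<in> Sym2" and B: "B \<in> Sym2" and eq: "F A = F B"
  shows "elliptic_cone (Lam / lam) (A - B)"
proof -
  have lam: "0 < lam" "lam \<le> Lam" using F by (auto simp: uniformly_elliptic_def)
  have ell: "lam * trace N \<le> F (C + N) - F C" "F (C + N) - F C \<le> Lam * trace N"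
    if "C $ 1 $ 2 = C $ 2 $ 1" "N $ 1 $ 2 = N $ 2 $ 1" "0 \<le> trace N" "0 \<le> det N" for C N
    using F pos_semidef_2[OF that(2-4)] that(1,2) by (auto simp: uniformly_elliptic_def Sym2_iff)
  define N where "N = A - B"
  have symA: "A $ 1 $ 2 = A $ 2 $ 1" and symB: "B $ 1 $ 2 = B $ 2 $ 1" using A B by (auto simp: Sym2_iff)
  have symN: "N $ 1 $ 2 = N $ 2 $ 1" using symA symB by (simp add: N_def)
  define x y z where "x = N $ 1 $ 1" "y = N $ 2 $ 1" "z = N $ 2 $ 2"
  define T where "T = x + z"
  have T: "trace N = T" by (simp add: T_def x_y_z_def trace_def sum_2)
  have det: "det N = x * z - y * y" using symN by (simp add: x_y_z_def det_2)
  define K where "K = Lam / lam"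
  have K: "1 \<le> K" using lam by (simp add: K_def)
  have "K * T\<^sup>2 \<le> (K - 1)\<^sup>2 * (- det N)"
  proof (cases "0 \<le> det N")
    case True
    \<comment> \<open>Here \<open>N\<close> or \<open>- N\<close> is positive semidefinite, and
      ellipticity forces its trace to vanish.\<close>
    have "T = 0"
    proof (cases "0 \<le> T")
      case Tp: True
      have "lam * T \<le> 0"
        using ell(1)[of B N] symB symN Tp True T eq by (simp add: N_def)
      then show ?thesis using Tp lam by (simp add: mult_le_0_iff)
    next
      case Tn: False
      have dN: "det (- N) = det N" by (simp add: det_2)
      have tN: "trace (- N) = - T" using T by (simp add: trace_def sum_2)
      have "lam * (- T) \<le> 0"
        using ell(1)[of A "- N"] symA symN Tn True dN tN eq by (simp add: N_def)
      then show ?thesis using Tn lam by (simp add: zero_le_mult_iff)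
    qed
    then have "z = - x" by (simp add: T_def)
    then have "0 \<le> - det N" by (simp add: det)
    then show ?thesis using \<open>T = 0\<close> mult_nonneg_nonneg[of "(K - 1)\<^sup>2" "- det N"] by simp
  next
    case False
    \<comment> \<open>Half the gap between the eigenvalues of \<open>N\<close>, which are
      \<open>p\<close> and \<open>- q\<close> below.\<close>
    define D where "D = sqrt (T\<^sup>2 / 4 - det N)"
    have D2: "D\<^sup>2 = T\<^sup>2 / 4 - det N" unfolding D_def using False zero_le_power2[of T] by (intro real_sqrt_pow2) linarith
    have "sqrt ((T / 2)\<^sup>2) < D"
      unfolding D_def using False by (intro real_sqrt_less_mono) (simp add: power_divide)
    then have DT: "\<bar>T / 2\<bar> < D" by simp
    define p q where "p = D + T / 2" and "q = D - T / 2"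
    have pq: "0 < p" "0 < q" "0 < D" "p + q = 2 * D" "p - q = T" using DT by (auto simp: p_def q_def)
    have pqd: "p * q = - det N" using D2 by (simp add: p_def q_def power2_eq_square field_simps)
    define k l where "k = p / (2 * D)" and "l = q / (2 * D)"
    have kl: "k * (2 * D) = p" "l * (2 * D) = q" "k + l = 1"
      using pq by (simp_all add: k_def l_def add_divide_distrib[symmetric])
    \<comment> \<open>\<open>N + mat q\<close> divided by \<open>p + q = 2 * D\<close> is the
      spectral projection for the eigenvalue \<open>p\<close>; times \<open>p\<close> it is the
      positive part of \<open>N\<close>. Likewise \<open>N2\<close> is the negative part.\<close>
    define N1 where "N1 = k *\<^sub>R (N + mat q)"
    define N2 where "N2 = l *\<^sub>R (mat p - N)"
    have comps: "N1 $ 1 $ 1 = k * (x + q)" "N1 $ 1 $ 2 = k * y"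
      "N1 $ 2 $ 1 = k * y" "N1 $ 2 $ 2 = k * (z + q)"
      "N2 $ 1 $ 1 = l * (p - x)" "N2 $ 1 $ 2 = l * (- y)"
      "N2 $ 2 $ 1 = l * (- y)" "N2 $ 2 $ 2 = l * (p - z)"
      using symN by (simp_all add: N1_def N2_def mat_def x_y_z_def)
    have tr1: "trace N1 = p"
    proof -
      have "trace N1 = k * (T + 2 * q)" by (simp add: trace_def sum_2 comps T_def algebra_simps)
      also have "T + 2 * q = 2 * D" using pq by simp
      finally show ?thesis using kl by simp
    qed
    have tr2: "trace N2 = q"
    proof -
      have "trace N2 = l * (2 * p - T)" by (simp add: trace_def sum_2 comps T_def algebra_simps)
      also have "2 * p - T = 2 * D" using pq by simp
      finally show ?thesis using kl by simp
    qed
    have d1: "(x + q) * (z + q) - y * y = 0" and d2: "(p - x) * (p - z) - y * y = 0"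
    proof -
      have "(x + q) * (z + q) - y * y = det N + q * (T + q)" by (simp add: det T_def algebra_simps)
      also have "T + q = p" using pq by simp
      finally show "(x + q) * (z + q) - y * y = 0" using pqd by (simp add: mult.commute)
      have "(p - x) * (p - z) - y * y = det N + p * (p - T)" by (simp add: det T_def algebra_simps)
      also have "p - T = q" using pq by simp
      finally show "(p - x) * (p - z) - y * y = 0" using pqd by simp
    qed
    have "det N1 = k\<^sup>2 * ((x + q) * (z + q) - y * y)"
      by (simp add: det_2 comps power2_eq_square right_diff_distrib mult_ac)
    then have det1: "det N1 = 0" by (simp add: d1)
    have "det N2 = l\<^sup>2 * ((p - x) * (p - z) - y * y)"
      by (simp add: det_2 comps power2_eq_square right_diff_distrib mult_ac)
    then have det2: "det N2 = 0" by (simp add: d2)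
    have "k * q = l * p" by (simp add: k_def l_def)
    then have "N1 - N2 = (k + l) *\<^sub>R N"
      unfolding N1_def N2_def by (simp add: vec_eq_iff mat_def algebra_simps)
    then have N12: "N = N1 - N2" using kl by simp
    define C where "C = B - N2"
    have sC: "C $ 1 $ 2 = C $ 2 $ 1" using symB comps by (simp add: C_def)
    have CA: "C + N1 = A" and CB: "C + N2 = B"
      using N12 by (auto simp: C_def N_def algebra_simps)
    have "lam * p \<le> Lam * q" "lam * q \<le> Lam * p"
      using ell[of C N1] ell[of C N2] sC comps tr1 tr2 det1 det2 pq CA CB eq by auto
    then have "p \<le> K * q" "q \<le> K * p" using lam by (auto simp: K_def field_simps)
    \<comment> \<open>The product of the two ratio bounds is the cone condition, since
      \<open>p * q = - det N\<close> and \<open>p - q\<close> is the trace.\<close>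
    then have "0 \<le> (K * q - p) * (K * p - q)" by simp
    also have "\<dots> = (K - 1)\<^sup>2 * (p * q) - K * (p - q)\<^sup>2"
      by (simp add: power2_eq_square algebra_simps)
    finally show ?thesis using pq(5) pqd by simp
  qed
  then show ?thesis
    using symN T by (simp add: elliptic_cone_def K_def N_def)
qed

text \<open>With q = lam/Lam the equation for the exponent is (1 + q) \<alpha>^2 + (3q + q^2)
  \<alpha> = 6 q^2. Writing \<alpha> = q w / (2 (1 + q)) turns it into w^2 + 2 (3 + q) w = 24 (1 +
  q), whose positive root contains the square root of \<open>alpha_tilde\<close>. The value 1 is
  attained for lam = Lam.\<close>

lemma growth_exponent_alpha_tilde:
  assumes "0 < lam" "lam \<le> Lam"
  shows "growth_exponent (Lam / lam) (alpha_tilde lam Lam)"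
proof -
  define q where "q = lam / Lam"
  have q: "0 < q" "q \<le> 1" using assms by (auto simp: q_def)
  have Kq: "Lam / lam = 1 / q" by (simp add: q_def)
  define s where "s = sqrt (33 + 30 * q + q\<^sup>2)"
  have s2: "s * s = 33 + 30 * q + q\<^sup>2" using q by (simp add: s_def)
  define w where "w = s - 3 - q"
  have w2: "w * w + 2 * (3 + q) * w = 24 * (1 + q)"
  proof -
    have "w * w + 2 * (3 + q) * w = s * s - (3 + q) * (3 + q)" by (simp add: w_def algebra_simps)
    then show ?thesis unfolding s2 by (simp add: power2_eq_square algebra_simps)
  qed
  have "lam / (2 * (Lam + lam)) = q / (2 * (1 + q))"
    using assms by (simp add: q_def field_simps)
  moreover have "alpha_tilde lam Lam = lam / (2 * (Lam + lam)) * w"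
    by (simp add: alpha_tilde_def w_def s_def q_def power_divide)
  ultimately have at: "alpha_tilde lam Lam = q / (2 * (1 + q)) * w" by simp
  define \<alpha> where "\<alpha> = q / (2 * (1 + q)) * w"
  have aw: "2 * (1 + q) * \<alpha> = q * w" using q by (simp add: \<alpha>_def)
  have "sqrt ((3 + q)\<^sup>2) < s"
    unfolding s_def using q by (intro real_sqrt_less_mono) (simp add: power2_eq_square algebra_simps)
  then have w0: "0 < w" using q by (simp add: w_def)
  then have a0: "0 < \<alpha>" using q by (simp add: \<alpha>_def)
  have "q\<^sup>2 \<le> 1" using q by (simp add: power_le_one)
  then have "s \<le> sqrt (8\<^sup>2)" unfolding s_def using q by (intro real_sqrt_le_mono) simp
  then have "w \<le> 5 - q" by (simp add: w_def)
  then have "q * w \<le> q * (5 - q)" using q by (intro mult_left_mono) auto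
  also have "\<dots> \<le> 2 * (1 + q)"
    using mult_nonneg_nonneg[of "1 - q" "2 - q"] q by (simp add: algebra_simps)
  finally have "2 * (1 + q) * \<alpha> \<le> 2 * (1 + q) * 1" using aw by simp
  then have a1: "\<alpha> \<le> 1" using q by (subst (asm) mult_le_cancel_left_pos) auto
  have quad: "(1 + q) * (\<alpha> * \<alpha>) + (3 * q + q * q) * \<alpha> = 6 * q * q"
  proof -
    have "4 * (1 + q) * ((1 + q) * (\<alpha> * \<alpha>) + (3 * q + q * q) * \<alpha>)
        = (2 * (1 + q) * \<alpha>) * (2 * (1 + q) * \<alpha>) + 2 * (3 * q + q * q) * (2 * (1 + q) * \<alpha>)"
      by (simp add: algebra_simps)
    also have "\<dots> = q * q * (w * w + 2 * (3 + q) * w)" unfolding aw by (simp add: algebra_simps)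
    also have "\<dots> = 4 * (1 + q) * (6 * q * q)" unfolding w2 by simp
    finally show ?thesis using q by simp
  qed
  have "(1 + q) * (\<alpha> * (\<alpha> + 2 * q / (1 + q) + q)) = (1 + q) * (\<alpha> * \<alpha>) + (3 * q + q * q) * \<alpha>"
    using q by (simp add: field_simps)
  also have "\<dots> = (1 + q) * (3 * (2 * q / (1 + q)) * q)" unfolding quad using q by simp
  finally have "(1 + q) * (\<alpha> * (\<alpha> + 2 * q / (1 + q) + q)) = (1 + q) * (3 * (2 * q / (1 + q)) * q)" .
  moreover have "1 + q \<noteq> 0" using q by simp
  ultimately have "\<alpha> * (\<alpha> + 2 * q / (1 + q) + q) = 3 * (2 * q / (1 + q)) * q"
    by (metis mult_left_cancel)
  moreover have "2 / (1 / q + 1) = 2 * q / (1 + q)" using q by (simp add: field_simps)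
  ultimately show ?thesis
    using a0 a1 q unfolding at Kq \<alpha>_def[symmetric] growth_exponent_def by simp
qed

section \<open>The interior estimate\<close>

lemma norm_mat2_le:
  fixes B :: "real^2^2"
  assumes "\<And>j. norm (B *v axis j 1) \<le> c"
  shows "norm B \<le> 4 * c"
proof -
  have e: "\<bar>B $ i $ j\<bar> \<le> c" for i j
  proof -
    have "\<bar>B $ i $ j\<bar> = \<bar>(B *v axis j 1) $ i\<bar>"
      by (simp add: matrix_vector_mult_basis column_def)
    also have "\<dots> \<le> norm (B *v axis j 1)" by (rule component_le_norm_cart)
    finally show ?thesis using assms[of j] by simp
  qed
  have r: "norm (B $ i) \<le> 2 * c" for i
    using norm_vec2_le[of "B $ i"] e[of i 1] e[of i 2] by simp
  have "norm B \<le> norm (B $ 1) + norm (B $ 2)"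
    using L2_set_le_sum[of UNIV "\<lambda>i. norm (B $ i)"] by (simp add: norm_vec_def[of B] sum_2)
  then show ?thesis using r[of 1] r[of 2] by simp
qed

lemma directional_derivative_tendsto:
  fixes f :: "'a::real_normed_vector \<Rightarrow> 'b::real_normed_vector"
  assumes "(f has_derivative L) (at x)"
  shows "((\<lambda>s. (1 / s) *\<^sub>R (f (x + s *\<^sub>R e) - f x)) \<longlongrightarrow> L e) (at_right 0)"
proof -
  have "((\<lambda>s. x + s *\<^sub>R e) has_derivative (\<lambda>s. s *\<^sub>R e)) (at 0)"
    by (auto intro!: derivative_eq_intros)
  from has_derivative_compose[OF this, of f L] assms
  have "((\<lambda>s. f (x + s *\<^sub>R e)) has_derivative (\<lambda>s. L (s *\<^sub>R e))) (at 0)" by simp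
  then have "((\<lambda>s. f (x + s *\<^sub>R e)) has_derivative (\<lambda>s. s *\<^sub>R L e)) (at 0 within {0<..})"
    unfolding linear_scale[OF has_derivative_linear[OF assms]] by (rule has_derivative_at_withinI)
  then have "((\<lambda>s. (1 / norm s) *\<^sub>R (f (x + s *\<^sub>R e) - (f x + s *\<^sub>R L e))) \<longlongrightarrow> 0) (at_right 0)"
    by (simp add: has_derivative_within)
  then have "((\<lambda>s. (1 / s) *\<^sub>R (f (x + s *\<^sub>R e) - f x) - L e) \<longlongrightarrow> 0) (at_right 0)"
  proof (rule Lim_transform_eventually)
    show "eventually (\<lambda>s. (1 / norm s) *\<^sub>R (f (x + s *\<^sub>R e) - (f x + s *\<^sub>R L e)) = (1 / s) *\<^sub>R (f (x + s *\<^sub>R e) - f x) - L e) (at_right 0)"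
      by (intro eventually_at_rightI[of 0 1]) (auto simp: algebra_simps)
  qed
  then show ?thesis by (simp add: LIM_zero_iff)
qed

text \<open>The first factor bounds the gradient; multiplied by
  \<open>8 * gradient_const K \<alpha>\<close> it bounds difference quotients of the gradient. The
  split 1028 = 4 + 8 * 128 covers the Hessian norm and points far apart,
  \<open>32 * holder_const K \<alpha>\<close> points close together.\<close>

definition C2_alpha_const :: "real \<Rightarrow> real \<Rightarrow> real"
  where "C2_alpha_const K \<alpha> = (32 + 32 * gradient_const K \<alpha>)
    * (1 + (1028 + 32 * holder_const K \<alpha>) * (8 * gradient_const K \<alpha>))"

lemma C2_alpha_const_pos: "1 \<le> K \<Longrightarrow> 0 < \<alpha> \<Longrightarrow> 0 < C2_alpha_const K \<alpha>"
  using holder_const_pos[of K \<alpha>] gradient_const_pos[of K \<alpha>]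
  by (auto simp: C2_alpha_const_def intro!: mult_pos_pos add_pos_pos)

text \<open>Radii shrink by an eighth per stage: 7/8 for the gradient and its increments, 3/4 for
  the Lipschitz bound on \<open>u\<close>, 5/8 for difference quotients of the gradient, 1/2 for the
  Hessian. Shifts of length at most 1/16 keep all translates in the unit ball.\<close>

lemma C2_alpha_estimate:
  assumes ell: "uniformly_elliptic lam Lam F" and C2u: "C2_on (ball 0 1) u"
    and eq: "\<And>z. z \<in> ball 0 1 \<Longrightarrow> F (hessian u z) = 0" and A: "\<And>z. z \<in> ball 0 1 \<Longrightarrow> \<bar>u z\<bar> \<le> A"
    and \<alpha>: "growth_exponent (Lam / lam) \<alpha>"
    and x: "x \<in> ball 0 (1 / 2)" and y: "y \<in> ball 0 (1 / 2)"
  defines "C \<equiv> C2_alpha_const (Lam / lam) \<alpha>"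
  shows "norm (gradient u x) \<le> C * A" and "norm (hessian u x) \<le> C * A"
    and "norm (hessian u x - hessian u y) \<le> C * A * dist x y powr \<alpha>"
proof -
  have lam: "0 < lam" "lam \<le> Lam" using ell by (auto simp: uniformly_elliptic_def)
  define K where "K = Lam / lam"
  have K: "1 \<le> K" using lam by (simp add: K_def)
  have \<alpha>: "growth_exponent K \<alpha>" unfolding K_def by (rule \<alpha>)
  then have \<alpha>0: "0 < \<alpha>" "\<alpha> \<le> 1" by (auto simp: growth_exponent_def)
  define G where "G = gradient_const K \<alpha>"
  have G: "0 < G" unfolding G_def using K \<alpha>0 by (intro gradient_const_pos)
  define H where "H = holder_const K \<alpha>"
  have H: "0 < H" unfolding H_def using K \<alpha>0 by (intro holder_const_pos)
  define C2 where "C2 = 32 + 32 * G"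
  define C3 where "C3 = 8 * G * C2"
  have C23: "0 < C2" "0 < C3" using G by (auto simp: C2_def C3_def)
  have C: "C = C2 + 4 * C3 + 32 * H * C3 + 1024 * C3"
    by (simp add: C_def C2_alpha_const_def C2_def C3_def G_def H_def K_def algebra_simps)
  define f M where "f = gradient u" and "M = hessian u"
  have A0: "0 \<le> A" using A[of 0] by simp
  have du: "(u has_derivative (\<lambda>h. f z \<bullet> h)) (at z)" if "z \<in> ball 0 1" for z
    unfolding f_def using C2u that by (intro gradient_works) (auto simp: C2_on_def)
  have df: "(f has_derivative (\<lambda>h. M z *v h)) (at z)" if "z \<in> ball 0 1" for z
    unfolding f_def M_def using hessian_works[OF C2u that] .
  have cM: "continuous_on (ball 0 1) M" using C2u by (simp add: C2_on_def M_def)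
  have sym: "M z \<in> Sym2" if "z \<in> ball 0 1" for z
    unfolding M_def Sym2_iff using hessian_symmetric[OF C2u open_ball that] .
  have cone: "elliptic_cone K (M z - M w)" if "z \<in> ball 0 1" "w \<in> ball 0 1" for z w
    unfolding K_def using that sym eq by (intro elliptic_cone_diff[OF ell]) (auto simp: M_def)
  have E: "elliptic_field (\<lambda>z. c *\<^sub>R (f (z + h) - f z)) (\<lambda>z. c *\<^sub>R (M (z + h) - M z)) S K"
    if S: "\<And>z. z \<in> S \<Longrightarrow> z \<in> ball 0 1 \<and> z + h \<in> ball 0 1" for c h S
  proof
    fix z assume z: "z \<in> S"
    have "((\<lambda>z. f (z + h)) has_derivative (\<lambda>k. M (z + h) *v k)) (at z)"
      using S[OF z] by (intro has_derivative_compose[where f = "\<lambda>z. z + h" and f' = "\<lambda>k. k", OF _ df])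
        (auto intro!: derivative_eq_intros)
    then have "((\<lambda>z. c *\<^sub>R (f (z + h) - f z)) has_derivative (\<lambda>k. c *\<^sub>R (M (z + h) *v k - M z *v k))) (at z)"
      using S[OF z] by (intro has_derivative_scaleR_right has_derivative_diff df) auto
    then show "((\<lambda>z. c *\<^sub>R (f (z + h) - f z)) has_derivative (\<lambda>k. (c *\<^sub>R (M (z + h) - M z)) *v k)) (at z)"
      by (simp add: matrix_vector_mult_diff_rdistrib scaleR_matrix_vector_assoc[symmetric])
    show "elliptic_cone K (c *\<^sub>R (M (z + h) - M z))"
      using S[OF z] by (intro elliptic_cone_scaleR cone) auto
  next
    show "continuous_on S (\<lambda>z. c *\<^sub>R (M (z + h) - M z))"
      using S by (intro continuous_intros continuous_on_compose2[OF cM] continuous_on_subset[OF cM]) auto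
  qed (rule K)
  have dv: "((\<lambda>z. c * (u (z + h) - u z)) has_derivative (\<lambda>k. (c *\<^sub>R (f (z + h) - f z)) \<bullet> k)) (at z)"
    if "z \<in> ball 0 1" "z + h \<in> ball 0 1" for c h z
  proof -
    have "((\<lambda>z. u (z + h)) has_derivative (\<lambda>k. f (z + h) \<bullet> k)) (at z)"
      using that by (intro has_derivative_compose[where f = "\<lambda>z. z + h" and f' = "\<lambda>k. k", OF _ du])
        (auto intro!: derivative_eq_intros)
    then have "((\<lambda>z. c * (u (z + h) - u z)) has_derivative (\<lambda>k. c * (f (z + h) \<bullet> k - f z \<bullet> k))) (at z)"
      using that by (intro has_derivative_mult_right has_derivative_diff du) auto
    then show ?thesis by (simp add: inner_diff_left)
  qed
  have inb: "z \<in> ball 0 s" if "z \<in> ball w r" "w \<in> ball 0 q" "q + r \<le> s" for z w :: "real^2" and r q s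
    using that norm_triangle_ineq[of w "z - w"] by (simp add: dist_norm norm_minus_commute)
  have inbh: "z + h \<in> ball 0 s" if "z \<in> ball 0 q" "norm h \<le> r" "q + r \<le> s" for z h :: "real^2" and r q s
    using that norm_triangle_ineq[of z h] by simp
  have s1: "norm (f (z + h) - f z) \<le> 32 * G * A" if z: "z \<in> ball 0 (7 / 8)" and h: "norm h \<le> 1 / 16" for z h
  proof -
    have S: "p \<in> ball 0 1 \<and> p + h \<in> ball 0 1" if "p \<in> ball z (1 / 16)" for p
      using inb[OF that z, of "15 / 16"] inbh[of p "15 / 16" h "1 / 16" 1] h by auto
    have "norm (1 *\<^sub>R (f (z + h) - f z)) \<le> G * (2 * A) / (1 / 16)"
      unfolding G_def
    proof (rule interior_gradient_bound[OF E[OF S] \<alpha>])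
      show "((\<lambda>z. 1 * (u (z + h) - u z)) has_derivative (\<lambda>k. (1 *\<^sub>R (f (p + h) - f p)) \<bullet> k)) (at p)"
        if "p \<in> ball z (1 / 16)" for p
        using S[OF that] by (intro dv) auto
      show "\<bar>1 * (u (p + h) - u p)\<bar> \<le> 2 * A" if "p \<in> ball z (1 / 16)" for p
        using S[OF that] A[of p] A[of "p + h"] by simp
    qed auto
    then show ?thesis by simp
  qed
  \<comment> \<open>By the mean value theorem some point within 1/16 of \<open>z\<close> has slope
    at most \<open>32 * A\<close> in the direction of the gradient at \<open>z\<close>;
    \<open>s1\<close> carries this back to \<open>z\<close>.\<close>
  have s2: "norm (f z) \<le> C2 * A" if z: "z \<in> ball 0 (7 / 8)" for z
  proof (cases "f z = 0")
    case True
    then show ?thesis using A0 C23 by simp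
  next
    case False
    define n where "n = norm (f z)"
    define e where "e = (1 / n) *\<^sub>R f z"
    have n: "0 < n" using False by (simp add: n_def)
    have e: "norm e = 1" "f z \<bullet> e = n"
      using n by (auto simp: e_def n_def power2_norm_eq_inner[symmetric] power2_eq_square)
    have in1: "z + s *\<^sub>R e \<in> ball 0 1" if "0 \<le> s" "s \<le> 1 / 16" for s
      using inbh[OF z, of "s *\<^sub>R e" "1 / 16" 1] e that by auto
    have "((\<lambda>s. u (z + s *\<^sub>R e)) has_real_derivative f (z + s *\<^sub>R e) \<bullet> e) (at s)"
      if "0 \<le> s" "s \<le> 1 / 16" for s
    proof -
      have "((\<lambda>s. z + s *\<^sub>R e) has_derivative (\<lambda>h. h *\<^sub>R e)) (at s)"
        by (auto intro!: derivative_eq_intros)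
      from has_derivative_compose[OF this du[OF in1[OF that]]]
      show ?thesis by (rule has_derivative_imp_has_field_derivative) simp
    qed
    from MVT2[OF _ this, of 0 "1 / 16"] obtain s where s: "0 < s" "s < 1 / 16"
      "u (z + (1 / 16) *\<^sub>R e) - u (z + 0 *\<^sub>R e) = (1 / 16 - 0) * (f (z + s *\<^sub>R e) \<bullet> e)" by auto
    have "\<bar>(f (z + s *\<^sub>R e) - f z) \<bullet> e\<bar> \<le> norm (f (z + s *\<^sub>R e) - f z) * norm e"
      by (rule Cauchy_Schwarz_ineq2)
    also have "\<dots> \<le> 32 * G * A" using s1[OF z, of "s *\<^sub>R e"] e s by simp
    finally have "\<bar>f (z + s *\<^sub>R e) \<bullet> e - n\<bar> \<le> 32 * G * A" by (simp only: inner_diff_left e(2))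
    moreover have "f (z + s *\<^sub>R e) \<bullet> e \<le> 32 * A"
      using s(3) A[OF in1[of "1 / 16"]] A[OF in1[of 0]] by simp
    ultimately have "n \<le> 32 * A + 32 * G * A" by linarith
    then show ?thesis by (simp add: n_def C2_def algebra_simps)
  qed
  have lipu: "\<bar>u (z + h) - u z\<bar> \<le> C2 * A * norm h" if z: "z \<in> ball 0 (3 / 4)" and h: "norm h \<le> 1 / 16" for z h
  proof -
    have "norm (u (z + h) - u z) \<le> C2 * A * norm ((z + h) - z)"
    proof (rule differentiable_bound[of "ball 0 (7 / 8)" u "\<lambda>p k. f p \<bullet> k"])
      show "(u has_derivative (\<lambda>k. f p \<bullet> k)) (at p within ball 0 (7 / 8))" if "p \<in> ball 0 (7 / 8)" for p
        using that by (auto intro: has_derivative_at_withinI[OF du])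
      show "onorm (\<lambda>k. f p \<bullet> k) \<le> C2 * A" if "p \<in> ball 0 (7 / 8)" for p
      proof (rule onorm_bound)
        show "norm (f p \<bullet> k) \<le> C2 * A * norm k" for k
          unfolding real_norm_def
          by (rule order_trans[OF Cauchy_Schwarz_ineq2 mult_right_mono[OF s2[OF that] norm_ge_zero]])
      qed (use A0 C23 in simp)
      show "z + h \<in> ball 0 (7 / 8)" by (rule inbh[OF z h]) simp
      show "z \<in> ball 0 (7 / 8)" using z by simp
    qed (rule convex_ball)
    then show ?thesis by simp
  qed
  have s3: "norm ((1 / norm h) *\<^sub>R (f (z + h) - f z)) \<le> C3 * A"
    if z: "z \<in> ball 0 (5 / 8)" and h: "0 < norm h" "norm h \<le> 1 / 16" for z h
  proof -
    have S': "p \<in> ball 0 (3 / 4)" if "p \<in> ball z (1 / 8)" for p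
      using inb[OF that z, of "3 / 4"] by simp
    have S: "p \<in> ball 0 1 \<and> p + h \<in> ball 0 1" if "p \<in> ball z (1 / 8)" for p
      using S'[OF that] inbh[of p "3 / 4" h "1 / 16" 1] h by auto
    have "norm ((1 / norm h) *\<^sub>R (f (z + h) - f z)) \<le> G * (C2 * A) / (1 / 8)"
      unfolding G_def
    proof (rule interior_gradient_bound[OF E[OF S] \<alpha>])
      show "((\<lambda>z. (1 / norm h) * (u (z + h) - u z)) has_derivative (\<lambda>k. ((1 / norm h) *\<^sub>R (f (p + h) - f p)) \<bullet> k)) (at p)"
        if "p \<in> ball z (1 / 8)" for p
        using S[OF that] by (intro dv) auto
      show "\<bar>(1 / norm h) * (u (p + h) - u p)\<bar> \<le> C2 * A" if "p \<in> ball z (1 / 8)" for p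
        using lipu[OF S'[OF that] h(2)] h(1) by (simp add: abs_mult field_simps)
    qed auto
    then show ?thesis by (simp add: C3_def mult_ac)
  qed
  \<comment> \<open>Bounds on difference quotients that are uniform in the step pass to the Hessian
    through this limit.\<close>
  have quot: "((\<lambda>s. (1 / norm (s *\<^sub>R e)) *\<^sub>R (f (z + s *\<^sub>R e) - f z)) \<longlongrightarrow> M z *v e) (at_right 0)"
    if "z \<in> ball 0 1" "norm e = 1" for z e
  proof (rule Lim_transform_eventually[OF directional_derivative_tendsto[OF df[OF that(1)], of e]])
    show "eventually (\<lambda>s. (1 / s) *\<^sub>R (f (z + s *\<^sub>R e) - f z) = (1 / norm (s *\<^sub>R e)) *\<^sub>R (f (z + s *\<^sub>R e) - f z)) (at_right 0)"
      using that(2) by (intro eventually_at_rightI[of 0 1]) auto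
  qed
  have small: "eventually (\<lambda>s. 0 < norm (s *\<^sub>R e) \<and> norm (s *\<^sub>R e) \<le> 1 / 16) (at_right 0)"
    if "norm e = 1" for e :: "real^2"
    using that by (intro eventually_at_rightI[of 0 "1 / 16"]) auto
  have hess: "norm (M z) \<le> 4 * (C3 * A)" if z: "z \<in> ball 0 (1 / 2)" for z
  proof (rule norm_mat2_le)
    fix j :: 2
    have z': "z \<in> ball 0 (5 / 8)" using z by simp
    have e: "norm (axis j 1 :: real^2) = 1" by simp
    have "((\<lambda>s. norm ((1 / norm (s *\<^sub>R axis j 1 :: real^2)) *\<^sub>R (f (z + s *\<^sub>R axis j 1) - f z))) \<longlongrightarrow> norm (M z *v axis j 1)) (at_right 0)"
      using z by (intro tendsto_norm quot e) auto
    then show "norm (M z *v axis j 1) \<le> C3 * A"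
    proof (rule tendsto_upperbound)
      show "eventually (\<lambda>s. norm ((1 / norm (s *\<^sub>R axis j 1 :: real^2)) *\<^sub>R (f (z + s *\<^sub>R axis j 1) - f z)) \<le> C3 * A) (at_right 0)"
        using small[OF e] by (rule eventually_mono) (use s3[OF z'] in blast)
    qed simp
  qed
  have CA: "c * A \<le> C * A" if "c \<le> C" for c using that A0 by (rule mult_right_mono)
  have Cs: "C2 \<le> C" "4 * C3 \<le> C" "32 * H * C3 \<le> C" "1024 * C3 \<le> C"
    using C23 H by (auto simp: C)
  have "norm (M x - M y) \<le> C * A * dist x y powr \<alpha>"
  \<comment> \<open>1/128 is a sixteenth of the radius 1/8, the range of
    \<open>elliptic_field_holder\<close>. Farther apart, \<open>128 * dist x y powr \<alpha>\<close>
    is at least 1 and the bound on the Hessian suffices.\<close>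
  proof (cases "dist x y \<le> 1 / 128")
    case True
    have "norm (M x - M y) \<le> 4 * (H * (C3 * A) * (dist x y / (1 / 8)) powr \<alpha>)"
    proof (rule norm_mat2_le)
      fix j :: 2
      let ?e = "axis j 1 :: real^2"
      have e: "norm ?e = 1" by simp
      have "((\<lambda>s. norm ((1 / norm (s *\<^sub>R ?e)) *\<^sub>R (f (x + s *\<^sub>R ?e) - f x) - (1 / norm (s *\<^sub>R ?e)) *\<^sub>R (f (y + s *\<^sub>R ?e) - f y)))
         \<longlongrightarrow> norm (M x *v ?e - M y *v ?e)) (at_right 0)"
        using x y by (intro tendsto_norm tendsto_diff quot e) auto
      then have "norm (M x *v ?e - M y *v ?e) \<le> H * (C3 * A) * (dist x y / (1 / 8)) powr \<alpha>"
      proof (rule tendsto_upperbound)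
        have "norm ((1 / norm h) *\<^sub>R (f (x + h) - f x) - (1 / norm h) *\<^sub>R (f (y + h) - f y)) \<le> H * (C3 * A) * (dist x y / (1 / 8)) powr \<alpha>"
          if h: "0 < norm h \<and> norm h \<le> 1 / 16" for h
        proof -
          have S': "p \<in> ball 0 (5 / 8)" if "p \<in> ball x (1 / 8)" for p
            using inb[OF that x, of "5 / 8"] by simp
          have S: "p \<in> ball 0 1 \<and> p + h \<in> ball 0 1" if "p \<in> ball x (1 / 8)" for p
            using S'[OF that] inbh[of p "5 / 8" h "1 / 16" 1] h by auto
          show ?thesis
            unfolding H_def
          proof (rule elliptic_field_holder[OF E[OF S] \<alpha>])
            show "norm ((1 / norm h) *\<^sub>R (f (p + h) - f p)) \<le> C3 * A" if "p \<in> ball x (1 / 8)" for p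
              using s3[OF S'[OF that]] h by blast
          qed (use True in auto)
        qed
        then show "eventually (\<lambda>s. norm ((1 / norm (s *\<^sub>R ?e)) *\<^sub>R (f (x + s *\<^sub>R ?e) - f x) - (1 / norm (s *\<^sub>R ?e)) *\<^sub>R (f (y + s *\<^sub>R ?e) - f y))
           \<le> H * (C3 * A) * (dist x y / (1 / 8)) powr \<alpha>) (at_right 0)"
          using small[OF e] by (elim eventually_mono) blast
      qed simp
      then show "norm ((M x - M y) *v ?e) \<le> H * (C3 * A) * (dist x y / (1 / 8)) powr \<alpha>"
        by (simp only: matrix_vector_mult_diff_rdistrib)
    qed
    also have "(dist x y / (1 / 8)) powr \<alpha> = dist x y powr \<alpha> * 8 powr \<alpha>"
      using powr_mult[of "dist x y" 8 \<alpha>] by simp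
    also have "4 * (H * (C3 * A) * (dist x y powr \<alpha> * 8 powr \<alpha>)) \<le> 4 * (H * (C3 * A) * (dist x y powr \<alpha> * 8))"
      using powr_mono[of \<alpha> 1 8] \<alpha>0 H C23 A0 by (intro mult_left_mono) auto
    also have "\<dots> = (32 * H * C3) * A * dist x y powr \<alpha>" by (simp add: mult_ac)
    also have "\<dots> \<le> C * A * dist x y powr \<alpha>" by (intro mult_right_mono[OF CA[OF Cs(3)]]) auto
    finally show ?thesis .
  next
    case False
    have "norm (M x - M y) \<le> norm (M x) + norm (M y)" by (rule norm_triangle_ineq4)
    also have "\<dots> \<le> 8 * C3 * A" using hess[OF x] hess[OF y] by simp
    also have "\<dots> \<le> 8 * C3 * A * (128 * dist x y powr \<alpha>)"
    proof -
      have "1 / 128 \<le> (1 / 128 :: real) powr \<alpha>"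
        using powr_mono'[of \<alpha> 1 "1 / 128"] \<alpha>0 by simp
      also have "\<dots> \<le> dist x y powr \<alpha>" using False \<alpha>0 by (intro powr_mono2) auto
      finally have "1 \<le> 128 * dist x y powr \<alpha>" by simp
      from mult_left_mono[OF this, of "8 * C3 * A"] show ?thesis using C23 A0 by simp
    qed
    also have "\<dots> = 1024 * C3 * A * dist x y powr \<alpha>" by (simp add: mult_ac)
    also have "\<dots> \<le> C * A * dist x y powr \<alpha>" by (intro mult_right_mono[OF CA[OF Cs(4)]]) auto
    finally show ?thesis .
  qed
  then show "norm (hessian u x - hessian u y) \<le> C * A * dist x y powr \<alpha>" by (simp add: M_def)
  show "norm (gradient u x) \<le> C * A" using s2[of x] x CA[OF Cs(1)] by (auto simp: f_def)
  show "norm (hessian u x) \<le> C * A" using hess[OF x] CA[OF Cs(2)] by (simp add: M_def)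
qed

text \<open>By continuity the points where |u| exceeds \<open>A\<close> form an open set; it is also
  null, hence empty.\<close>

lemma Linf_norm_on_bound:
  assumes u: "continuous_on S u" and S: "open S" and A: "Linf_norm_on S u = ennreal A" "0 \<le> A" and x: "x \<in> S"
  shows "\<bar>u x\<bar> \<le> A"
proof (rule ccontr)
  assume "\<not> \<bar>u x\<bar> \<le> A"
  define T where "T = {z \<in> S. A < \<bar>u z\<bar>}"
  have "open T"
  proof -
    have "T = S \<inter> (\<lambda>z. \<bar>u z\<bar>) -` {A<..}" by (auto simp: T_def)
    then show ?thesis
      using u S by (auto intro!: continuous_open_preimage continuous_intros)
  qed
  moreover have "x \<in> T" using x \<open>\<not> \<bar>u x\<bar> \<le> A\<close> by (simp add: T_def)
  ultimately have "\<not> negligible T" using open_not_negligible by blast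
  moreover have "negligible T"
  proof -
    have "AE z in lebesgue_on S. ennreal \<bar>u z\<bar> \<le> Linf_norm_on S u"
      unfolding Linf_norm_on_def by (rule esssup_AE)
    then have "AE z in lebesgue_on S. \<bar>u z\<bar> \<le> A"
      using A by simp
    then have "AE z in lebesgue. z \<in> S \<longrightarrow> \<bar>u z\<bar> \<le> A"
      using S by (subst (asm) AE_restrict_space_iff) auto
    then obtain Z where "Z \<in> null_sets lebesgue" "{z. \<not> (z \<in> S \<longrightarrow> \<bar>u z\<bar> \<le> A)} \<subseteq> Z"
      by (auto simp: eventually_ae_filter)
    then show ?thesis
      unfolding negligible_iff_null_sets[symmetric] T_def
      by (elim negligible_subset) auto
  qed
  ultimately show False by contradiction
qed

lemma sup_norm_on_le: "(\<And>x. x \<in> S \<Longrightarrow> norm (f x) \<le> c) \<Longrightarrow> sup_norm_on S f \<le> ennreal c"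
  unfolding sup_norm_on_def by (intro SUP_least ennreal_leI)

lemma holder_seminorm_on_le:
  assumes "\<And>x y. x \<in> S \<Longrightarrow> y \<in> S \<Longrightarrow> norm (f x - f y) \<le> c * dist x y powr \<alpha>"
  shows "holder_seminorm_on \<alpha> S f \<le> ennreal c"
  unfolding holder_seminorm_on_def
  using assms by (intro SUP_least) (auto intro!: ennreal_leI simp: divide_le_eq)

theorem theorem5p1:
  fixes lam Lam :: real
  assumes "0 < lam" and "lam \<le> Lam"
  shows "\<exists>C::real. 0 < C \<and>
    (\<forall>(F :: real^2^2 \<Rightarrow> real) (u :: real^2 \<Rightarrow> real).
       continuous_on Sym2 F \<longrightarrow>
       uniformly_elliptic lam Lam F \<longrightarrow>
       C2_on (ball 0 1) u \<longrightarrow>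
       (\<forall>x\<in>ball 0 1. F (hessian u x) = 0) \<longrightarrow>
       C2_holder_norm_on (alpha_tilde lam Lam) (ball 0 (1/2)) u
         \<le> ennreal C * Linf_norm_on (ball 0 1) u)"
proof -
  define \<alpha> where "\<alpha> = alpha_tilde lam Lam"
  have \<alpha>: "growth_exponent (Lam / lam) \<alpha>"
    unfolding \<alpha>_def by (rule growth_exponent_alpha_tilde[OF assms])
  define C where "C = C2_alpha_const (Lam / lam) \<alpha>"
  have C: "0 < C"
    unfolding C_def using assms \<alpha> by (intro C2_alpha_const_pos) (auto simp: growth_exponent_def)
  \<comment> \<open>The 1 pays for the sup norm of \<open>u\<close>, and one \<open>C\<close> for
    each of the other three terms of the norm.\<close>
  have "C2_holder_norm_on \<alpha> (ball 0 (1 / 2)) u \<le> ennreal (1 + 3 * C) * Linf_norm_on (ball 0 1) u"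
    if ell: "uniformly_elliptic lam Lam F" and u: "C2_on (ball 0 1) u"
      and eq: "\<forall>x\<in>ball 0 1. F (hessian u x) = 0" for F u
  proof (cases "Linf_norm_on (ball 0 1) u")
    case (real A)
    have "continuous_on (ball 0 1) u"
      using u by (intro differentiable_imp_continuous_on) (auto simp: C2_on_def differentiable_on_def intro: differentiable_at_withinI)
    then have A: "\<bar>u x\<bar> \<le> A" if "x \<in> ball 0 1" for x
      using Linf_norm_on_bound[OF _ open_ball real(2,1) that] by blast
    note est = C2_alpha_estimate[OF ell u eq[rule_format] A \<alpha>, folded C_def]
    have "C2_holder_norm_on \<alpha> (ball 0 (1 / 2)) u \<le> ennreal A + ennreal (C * A) + ennreal (C * A) + ennreal (C * A)"
      unfolding C2_holder_norm_on_def using est A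
      by (intro add_mono sup_norm_on_le holder_seminorm_on_le) auto
    also have "\<dots> = ennreal ((1 + 3 * C) * A)"
      using real(1) C by (simp add: ennreal_plus[symmetric] algebra_simps del: ennreal_plus)
    also have "\<dots> = ennreal (1 + 3 * C) * Linf_norm_on (ball 0 1) u"
      using real C by (simp add: ennreal_mult)
    finally show ?thesis .
  next
    \<comment> \<open>A positive constant times infinity is infinity, so there is nothing to
      bound.\<close>
    case top
    then show ?thesis using C by (simp add: ennreal_mult_top)
  qed
  then show ?thesis
    using C unfolding \<alpha>_def by (intro exI[of _ "1 + 3 * C"]) auto
qed


end
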